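(* Let $d\geq 1$ be an integer. For any closed symmetric convex sets $K,L\subset\mathbb{R}^d$ and any centered Gaussian measure $\mu$ on $\mathbb{R}^d$ we have $$\mu(K\cap L)\geq \mu(K)\mu(L).$$
   Context: A set $K\subset\mathbb{R}^d$ is symmetric if $K=-K$. A centered Gaussian measure on $\mathbb{R}^d$ is a Gaussian probability measure with mean zero; its covariance matrix may be any symmetric positive semidefinite matrix (degenerate covariance is allowed). *)

theory Defs
  imports "HOL-Probability.Probability"
begin

definition symmetric_set :: "'a::real_vector set \<Rightarrow> bool" where
  "symmetric_set S \<longleftrightarrow> S = uminus ` S"

(* The parameter s is the standard deviation; s = 0 gives the Dirac measure at m, which
   normal_density does not cover. *)
definition normal_distribution :: "real \<Rightarrow> real \<Rightarrow> real measure" where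
  "normal_distribution m s =
     (if s = 0 then return borel m else density lborel (\<lambda>x. ennreal (normal_density m s x)))"

(* A Borel probability measure is Gaussian if its image under every linear functional is a
   one-dimensional normal distribution. Functionals of variance 0 are permitted, so the
   covariance may be degenerate. *)
definition gaussian_measure :: "'a::euclidean_space measure \<Rightarrow> bool" where
  "gaussian_measure M \<longleftrightarrow>
     prob_space M \<and> sets M = sets borel \<and>
     (\<forall>u. \<exists>m s. 0 \<le> s \<and> distr M borel (\<lambda>x. u \<bullet> x) = normal_distribution m s)"

(* The identity is integrable with respect to every Gaussian measure, so the Bochner integral
   below is the genuine mean and not the default value 0 of a non-integrable function. *)
definition centered_gaussian_measure :: "'a::euclidean_space measure \<Rightarrow> bool" where
  "centered_gaussian_measure M \<longleftrightarrow> gaussian_measure M \<and> (\<integral>x. x \<partial>M) = 0"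

end

theory Submission
  imports Defs "HOL-Computational_Algebra.Polynomial"
begin

text \<open>
  Let \<open>X\<close> have the law \<open>\<mu>\<close>, let \<open>Y\<close> be an independent copy, and put
  \<open>X\<^sub>\<tau> = \<tau> X + sqrt (1 - \<tau>\<^sup>2) Y\<close>.  The probability that \<open>X \<in> K\<close> and \<open>X\<^sub>\<tau> \<in> L\<close> is
  \<open>\<mu>(K) \<mu>(L)\<close> for \<open>\<tau> = 0\<close> and \<open>\<mu>(K \<inter> L)\<close> for \<open>\<tau> = 1\<close>, so it suffices that it does not
  decrease on \<open>[0, 1]\<close>.  This is Royen's strategy; the version below replaces his densities of
  multivariate Gamma distributions by polynomials in exponentials, which removes all questions
  of degeneracy and regularity.

  Reduction.  A nonempty closed symmetric convex set is a countable intersection of symmetric slabs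
  (lemma \<open>closed_symmetric_convex_eq_slabs\<close>), so finitely many slabs may be considered.  The
  indicator of a slab \<open>{x. s(x) \<ge> 1/2}\<close>, where \<open>s(x) = exp (- (u \<bullet> x)\<^sup>2 / 2)\<close>, is the bounded
  pointwise limit of \<open>p(s(x))\<close> for polynomials \<open>p\<close> that are nonnegative and increasing on
  \<open>[0, 1]\<close>, for instance \<open>p(s) = 1 - (1 - s\<^sup>m)\<^sup>N\<close> with \<open>N = m 2\<^sup>m\<close>.  It remains to show that the
  expectation of \<open>\<Prod>i. p(s\<^sub>i)\<close> increases with \<open>\<tau>\<close>, where \<open>s\<^sub>i = exp (- (w\<^sub>i \<bullet> Z)\<^sup>2 / 2)\<close>,
  \<open>Z = (X, X\<^sub>\<tau>)\<close>, and each \<open>w\<^sub>i\<close> looks at one of the two components only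
  (lemma \<open>polynomial_correlation_mono\<close>).

  Laplace transforms.  Expanding \<open>p\<close>, this expectation is a linear combination of the numbers
  \<open>L(\<kappa>) = E exp (- (\<Sum>i. \<kappa>\<^sub>i (w\<^sub>i \<bullet> Z)\<^sup>2) / 2)\<close> with integral \<open>\<kappa>\<^sub>i \<ge> 0\<close>.  For real \<open>\<theta> \<ge> 0\<close> one has
  \<open>L(\<theta>) = D(\<theta>) powr (-1/2)\<close> with \<open>D(\<theta>) = det (1 + \<Theta> C\<^sub>\<tau>)\<close>, where \<open>C\<^sub>\<tau>\<close> is the covariance matrix
  of the \<open>w\<^sub>i \<bullet> Z\<close> and \<open>\<Theta>\<close> the diagonal matrix of the \<open>\<theta>\<^sub>i\<close>.  Besides
  differentiability in \<open>\<tau>\<close>, two properties of \<open>D\<close> matter.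
  It is affine in every single \<open>\<theta>\<^sub>i\<close>, which is visible when \<open>D\<close> is built up by adding the
  functionals one at a time, with \<open>w\<^sub>i\<close> added last.  And it decreases with \<open>\<tau>\<close>: the function
  \<open>exp (- (\<Sum>i. \<theta>\<^sub>i (u\<^sub>i \<bullet> x)\<^sup>2) / 2)\<close> is a mixture of cosines \<open>cos (a \<bullet> x)\<close>, and the expectation
  of \<open>cos (a \<bullet> X) cos (c \<bullet> X\<^sub>\<tau>)\<close> is a positive number independent of \<open>\<tau>\<close> times
  \<open>cosh (\<tau> b(a, c))\<close>, where \<open>b\<close> is the covariance form of \<open>\<mu>\<close>.

  The derivative.  Consequently \<open>- \<partial>D/\<partial>\<tau>\<close> is affine in every variable and nonnegative on the
  orthant, and such a function has nonnegative coefficients: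
  \<open>- \<partial>D/\<partial>\<tau> = (\<Sum>J. g\<^sub>J \<Prod>j\<in>J. \<theta>\<^sub>j)\<close> with \<open>g\<^sub>J \<ge> 0\<close> (lemma \<open>multiaffine_nonneg_coefficients\<close>).  Hence
  \<open>\<partial>L/\<partial>\<tau> = (\<Sum>J. g\<^sub>J (\<Prod>j\<in>J. \<theta>\<^sub>j)) L\<^sup>3 / 2\<close>.  Inside the linear combination, the factor \<open>\<Prod>j\<in>J. \<kappa>\<^sub>j\<close>
  replaces \<open>p(s\<^sub>j)\<close> by \<open>s\<^sub>j p'(s\<^sub>j) \<ge> 0\<close> for \<open>j \<in> J\<close>, and \<open>L\<^sup>3\<close> in place of \<open>L\<close> means that \<open>s\<^sub>i\<close> is the
  product of three independent copies, which still lies in \<open>[0, 1]\<close>.  So every term of the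
  derivative is the expectation of a nonnegative quantity.
\<close>

section \<open>One-dimensional Gaussian integrals\<close>

text \<open>
  Writing every normal law, the Dirac measures included, as an affine image of the standard one
  makes case distinctions on the variance unnecessary later.
\<close>

lemma normal_distribution_eq_distr:
  assumes "0 \<le> s"
  shows "normal_distribution m s = distr std_normal_distribution borel (\<lambda>g. m + s * g)"
proof (cases "s = 0")
  case True
  interpret prob_space std_normal_distribution
    by (rule prob_space_normal_density) simp
  show ?thesis
    using True distr_const[of m borel] by (simp add: normal_distribution_def)
next
  case False
  with assms have s: "s > 0" by simp
  interpret prob_space std_normal_distribution
    by (rule prob_space_normal_density) simp
  have "distributed std_normal_distribution lborel (\<lambda>g. g) std_normal_density"
    unfolding distributed_def by (auto simp: distr_id2)
  from normal_density_affine[OF this, of s m] s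
  have "distributed std_normal_distribution lborel (\<lambda>g. m + s * g) (normal_density m s)"
    by simp
  from distributed_distr_eq_density[OF this] show ?thesis
    using s by (simp add: normal_distribution_def cong: distr_cong)
qed

lemma integral_cos_std_normal: "(\<integral>g. cos (t * g) \<partial>std_normal_distribution) = exp (- t\<^sup>2 / 2)"
  and integral_sin_std_normal: "(\<integral>g. sin (t * g) \<partial>std_normal_distribution) = 0"
proof -
  interpret real_distribution std_normal_distribution
    by (rule real_dist_normal_dist)
  have i: "integrable std_normal_distribution (\<lambda>g. iexp (t * g))"
    by (rule integrable_iexp) auto
  have "(CLINT g|std_normal_distribution. iexp (t * g)) = complex_of_real (exp (- t\<^sup>2 / 2))"
    using char_std_normal_distribution by (simp add: char_def fun_eq_iff)
  then have "Re (CLINT g|std_normal_distribution. iexp (t * g)) = exp (- t\<^sup>2 / 2)"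
    "Im (CLINT g|std_normal_distribution. iexp (t * g)) = 0" by (simp_all only: Re_complex_of_real Im_complex_of_real)
  then show "(\<integral>g. cos (t * g) \<partial>std_normal_distribution) = exp (- t\<^sup>2 / 2)"
    "(\<integral>g. sin (t * g) \<partial>std_normal_distribution) = 0"
    using integral_Re[OF i] integral_Im[OF i]
    by (simp_all add: Re_exp Im_exp)
qed

text \<open>
  Completing the square turns the integrand into a multiple of the normal density with mean
  \<open>- \<beta> / (1 + \<kappa>)\<close> and variance \<open>1 / (1 + \<kappa>)\<close>, whose integral is 1.
\<close>

lemma integral_exp_quadratic_std_normal:
  assumes "0 \<le> \<kappa>"
  shows "(\<integral>g. exp (- (\<alpha> + 2 * \<beta> * g + \<kappa> * g\<^sup>2) / 2) \<partial>std_normal_distribution)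
    = exp (- (\<alpha> - \<beta>\<^sup>2 / (1 + \<kappa>)) / 2) / sqrt (1 + \<kappa>)"
proof -
  let ?c = "1 + \<kappa>"
  let ?C = "exp (- (\<alpha> - \<beta>\<^sup>2 / ?c) / 2) / sqrt ?c"
  have c: "?c > 0" using assms by simp
  have "std_normal_density g * exp (- (\<alpha> + 2 * \<beta> * g + \<kappa> * g\<^sup>2) / 2)
      = ?C * normal_density (- \<beta> / ?c) (1 / sqrt ?c) g" for g
  proof -
    have sq: "(1 / sqrt ?c)\<^sup>2 = 1 / ?c" using c by (simp add: power_divide)
    have "- g\<^sup>2 / 2 + (- (\<alpha> + 2 * \<beta> * g + \<kappa> * g\<^sup>2) / 2)
      = - (\<alpha> - \<beta>\<^sup>2 / ?c) / 2 - (g - (- \<beta> / ?c))\<^sup>2 * ?c / 2"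
    proof -
      define m where "m = \<beta> / ?c"
      have \<beta>: "\<beta> = ?c * m" using c by (simp add: m_def)
      have "\<beta>\<^sup>2 / ?c = ?c * m\<^sup>2" "- \<beta> / ?c = - m"
        using c by (simp_all add: \<beta> power2_eq_square)
      then show ?thesis
        unfolding \<beta> by (simp add: field_simps power2_eq_square)
    qed
    then have "exp (- g\<^sup>2 / 2) * exp (- (\<alpha> + 2 * \<beta> * g + \<kappa> * g\<^sup>2) / 2)
      = exp (- (\<alpha> - \<beta>\<^sup>2 / ?c) / 2) * exp (- (g - (- \<beta> / ?c))\<^sup>2 * ?c / 2)"
      by (simp flip: exp_add)
    moreover have "normal_density (- \<beta> / ?c) (1 / sqrt ?c) g
       = sqrt ?c / sqrt (2 * pi) * exp (- (g - (- \<beta> / ?c))\<^sup>2 * ?c / 2)"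
      unfolding normal_density_def sq using c by (simp add: real_sqrt_divide)
    ultimately show ?thesis
      using c by (simp add: std_normal_density_def)
  qed
  then show ?thesis
    using c by (simp add: integral_density)
qed

section \<open>Covariance forms\<close>

text \<open>
  Only the real part of the characteristic function is recorded, which suffices to integrate the
  even functions below.  The form may be degenerate.
\<close>

definition has_covariance_form :: "'a::euclidean_space measure \<Rightarrow> ('a \<Rightarrow> 'a \<Rightarrow> real) \<Rightarrow> bool" where
  "has_covariance_form M b \<longleftrightarrow> prob_space M \<and> sets M = sets borel \<and> bilinear b \<and>
     (\<forall>u v. b u v = b v u) \<and> (\<forall>u. (\<integral>x. cos (u \<bullet> x) \<partial>M) = exp (- b u u / 2))"

text \<open>
  The form consists of the second moments.  Each functional has finite second moments because it
  is an affine function of a standard normal variable; its mean vanishes because the identity is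
  integrable and has integral 0.
\<close>

lemma centered_gaussian_measure_covariance:
  fixes M :: "'a::euclidean_space measure"
  assumes "centered_gaussian_measure M"
  obtains b where "has_covariance_form M b" and "\<And>u. (\<integral>x. sin (u \<bullet> x) \<partial>M) = 0"
proof -
  have P: "prob_space M" and S[measurable_cong]: "sets M = sets borel" and mean: "(\<integral>x. x \<partial>M) = 0"
    and N: "\<And>u. \<exists>m s. 0 \<le> s \<and> distr M borel (\<lambda>x. u \<bullet> x) = normal_distribution m s"
    using assms by (auto simp: centered_gaussian_measure_def gaussian_measure_def)
  interpret prob_space M by (rule P)
  let ?G = "std_normal_distribution"
  interpret G: prob_space ?G by (rule prob_space_normal_density) simp
  have G1: "integrable ?G (\<lambda>g. g)" "(\<integral>g. g \<partial>?G) = 0"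
    using integrable_std_normal_distribution_moment[of 1] integral_std_normal_distribution_moment_odd[of 1]
    by simp_all
  have G2: "integrable ?G (\<lambda>g. g\<^sup>2)" "(\<integral>g. g\<^sup>2 \<partial>?G) = 1"
    using std_normal_distribution_even_moments[of 1] by simp_all
  have "\<exists>m s. distr M borel (\<lambda>x. u \<bullet> x) = distr ?G borel (\<lambda>g. m + s * g)" for u
    using N[of u] normal_distribution_eq_distr by metis
  then obtain m s where D: "\<And>u. distr M borel (\<lambda>x. u \<bullet> x) = distr ?G borel (\<lambda>g. m u + s u * g)"
    by metis
  have transfer_int: "(\<integral>x. f (u \<bullet> x) \<partial>M) = (\<integral>g. f (m u + s u * g) \<partial>?G)"
    and transfer_integrable: "integrable M (\<lambda>x. f (u \<bullet> x)) \<longleftrightarrow> integrable ?G (\<lambda>g. f (m u + s u * g))"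
    if [measurable]: "f \<in> borel_measurable borel" for f :: "real \<Rightarrow> real" and u
  proof -
    show "(\<integral>x. f (u \<bullet> x) \<partial>M) = (\<integral>g. f (m u + s u * g) \<partial>?G)"
      using arg_cong[OF D[of u], of "\<lambda>N. integral\<^sup>L N f"] by (simp add: integral_distr)
    show "integrable M (\<lambda>x. f (u \<bullet> x)) \<longleftrightarrow> integrable ?G (\<lambda>g. f (m u + s u * g))"
      using arg_cong[OF D[of u], of "\<lambda>N. integrable N f"] by (simp add: integrable_distr_eq)
  qed
  have int1: "integrable M (\<lambda>x. u \<bullet> x)" for u
  proof (rule iffD2[OF transfer_integrable[of "\<lambda>y. y"]])
    show "integrable ?G (\<lambda>g. m u + s u * g)"
      by (intro Bochner_Integration.integrable_add integrable_mult_right G.integrable_const G1(1))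
  qed simp
  have int2: "integrable M (\<lambda>x. (u \<bullet> x)\<^sup>2)" for u
  proof (rule iffD2[OF transfer_integrable[of "\<lambda>y. y\<^sup>2"]])
    have "(m u + s u * g)\<^sup>2 = (m u)\<^sup>2 + (2 * m u * s u) * g + (s u)\<^sup>2 * g\<^sup>2" for g
      by (simp add: power2_eq_square algebra_simps)
    then show "integrable ?G (\<lambda>g. (m u + s u * g)\<^sup>2)"
      by (simp only:) (intro Bochner_Integration.integrable_add integrable_mult_right G.integrable_const G1(1) G2(1))
  qed simp
  have "integrable M (\<lambda>x. \<Sum>e\<in>Basis. (e \<bullet> x) *\<^sub>R e)"
    using int1 by (intro Bochner_Integration.integrable_sum integrable_scaleR_left) auto
  then have id: "integrable M (\<lambda>x. x)"
    by (simp add: euclidean_representation inner_commute[of _ "_::'a"])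
  have m0: "m u = 0" for u
  proof -
    have "(\<integral>x. u \<bullet> x \<partial>M) = 0"
      using integral_inner_left[of u M "\<lambda>x. x"] id mean by (simp add: inner_commute)
    moreover have "(\<integral>g. m u + s u * g \<partial>?G) = m u"
      using G.prob_space by (subst Bochner_Integration.integral_add[OF G.integrable_const integrable_mult_right[OF G1(1)]])
        (simp add: G1(2))
    ultimately show ?thesis
      using transfer_int[OF measurable_ident, of u] by (simp only: id_def)
  qed
  define b where "b u v = (\<integral>x. (u \<bullet> x) * (v \<bullet> x) \<partial>M)" for u v
  have int12: "integrable M (\<lambda>x. (u \<bullet> x) * (v \<bullet> x))" for u v
  proof -
    have "(u \<bullet> x) * (v \<bullet> x) = (((u + v) \<bullet> x)\<^sup>2 - ((u - v) \<bullet> x)\<^sup>2) / 4" for x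
      by (simp add: power2_eq_square inner_left_distrib inner_diff_left algebra_simps)
    then show ?thesis
      by (simp only:) (intro integrable_divide Bochner_Integration.integrable_diff int2)
  qed
  have buu: "b u u = (s u)\<^sup>2" for u
    using transfer_int[OF borel_measurable_power[OF measurable_ident], of u 2] G2(2)
    by (simp only: b_def m0 id_def power2_eq_square[symmetric] power_mult_distrib add_0 integral_mult_right_zero mult_1_right)
  have "bilinear b"
  proof -
    have swap: "(u \<bullet> x) * (r * (v \<bullet> x)) = r * ((u \<bullet> x) * (v \<bullet> x))" for u v x :: 'a and r
      by simp
    show ?thesis
      unfolding bilinear_def using int12
      by (auto intro!: linearI simp: b_def inner_left_distrib distrib_right distrib_left mult.assoc swap)
  qed
  moreover have "b u v = b v u" for u v by (simp add: b_def mult.commute)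
  moreover have "(\<integral>x. cos (u \<bullet> x) \<partial>M) = exp (- b u u / 2)" for u
    using transfer_int[of cos u] m0 by (simp add: integral_cos_std_normal buu)
  ultimately have "has_covariance_form M b"
    using P S by (simp add: has_covariance_form_def)
  moreover have "(\<integral>x. sin (u \<bullet> x) \<partial>M) = 0" for u
    using transfer_int[of sin u] m0 by (simp add: integral_sin_std_normal)
  ultimately show thesis by (rule that)
qed

lemma quadratic_form_add:
  fixes b :: "'a::real_vector \<Rightarrow> 'a \<Rightarrow> real"
  assumes "bilinear b" "\<And>u v. b u v = b v u"
  shows "b (u + t *\<^sub>R w) (u + t *\<^sub>R w) = b u u + 2 * t * b u w + t\<^sup>2 * b w w"
  using assms(2)[of w u]
  by (simp add: bilinear_ladd[OF assms(1)] bilinear_radd[OF assms(1)] bilinear_lmul[OF assms(1)]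
      bilinear_rmul[OF assms(1)] power2_eq_square algebra_simps)

section \<open>Laplace transforms of squared functionals\<close>

text \<open>
  If \<open>b\<close> is the covariance form of a Gaussian measure, this is the covariance form of the Gaussian
  measure whose density with respect to it is proportional to
  \<open>exp (- (\<Sum>(l, w). l (w \<bullet> x)\<^sup>2) / 2)\<close>.  Adding one pair is a rank-one update, that is, one step of
  Gaussian elimination, with the head of the list as the pair added last.
\<close>

fun tilted_form :: "('a \<Rightarrow> 'a \<Rightarrow> real) \<Rightarrow> (real \<times> 'a) list \<Rightarrow> 'a \<Rightarrow> 'a \<Rightarrow> real" where
  "tilted_form b [] = b"
| "tilted_form b ((l, w) # ls) = (\<lambda>u v. tilted_form b ls u v -
     l * tilted_form b ls u w * tilted_form b ls v w / (1 + l * tilted_form b ls w w))"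

text \<open>
  The determinant of \<open>1 + \<Lambda> C\<close>, where \<open>C\<close> is the matrix of the numbers \<open>b w\<^sub>i w\<^sub>j\<close> and \<open>\<Lambda>\<close> the diagonal
  matrix of the \<open>l\<^sub>i\<close>, given as the product of its pivots.  In this form it is evidently affine in
  the coefficient of the head of the list.
\<close>

fun laplace_det :: "('a \<Rightarrow> 'a \<Rightarrow> real) \<Rightarrow> (real \<times> 'a) list \<Rightarrow> real" where
  "laplace_det b [] = 1"
| "laplace_det b ((l, w) # ls) = laplace_det b ls * (1 + l * tilted_form b ls w w)"

definition gauss_weight :: "(real \<times> 'a::real_inner) list \<Rightarrow> 'a \<Rightarrow> real" where
  "gauss_weight ls x = (\<Prod>(l, w)\<leftarrow>ls. exp (- l * (w \<bullet> x)\<^sup>2 / 2))"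

lemma gauss_weight_simps [simp]:
  "gauss_weight [] x = 1"
  "gauss_weight ((l, w) # ls) x = exp (- l * (w \<bullet> x)\<^sup>2 / 2) * gauss_weight ls x"
  by (simp_all add: gauss_weight_def)

lemma gauss_weight_pos: "0 < gauss_weight ls x"
  by (induction ls) (auto split: prod.splits)

lemma gauss_weight_le_1: "\<forall>(l, w)\<in>set ls. 0 \<le> l \<Longrightarrow> gauss_weight ls x \<le> 1"
proof (induction ls)
  case (Cons a ls)
  obtain l w where a: "a = (l, w)" by (cases a)
  have "exp (- l * (w \<bullet> x)\<^sup>2 / 2) * gauss_weight ls x \<le> 1 * 1"
    using Cons a gauss_weight_pos[of ls x] by (intro mult_mono) auto
  then show ?case by (simp add: a)
qed simp

lemma gauss_weight_measurable [measurable]: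
  "gauss_weight ls \<in> borel_measurable (borel :: 'a::euclidean_space measure)"
proof (induction ls)
  case Nil
  then show ?case by (simp add: gauss_weight_def[abs_def])
next
  case (Cons a ls)
  obtain l w where a: "a = (l, w)" by (cases a)
  have "gauss_weight (a # ls) = (\<lambda>x. exp (- l * (w \<bullet> x)\<^sup>2 / 2) * gauss_weight ls x)"
    by (auto simp: a)
  also have "\<dots> \<in> borel_measurable borel" using Cons by measurable
  finally show ?case .
qed

text \<open>
  This trades the square of a functional in an exponent for a random linear functional, and
  integrals of cosines of linear functionals are what a covariance form provides.
\<close>

lemma exp_square_eq_integral_cos:
  assumes "0 \<le> l"
  shows "exp (- l * y\<^sup>2 / 2) = (\<integral>g. cos (sqrt l * g * y) \<partial>std_normal_distribution)"
  using integral_cos_std_normal[of "sqrt l * y"] assms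
  by (simp add: power_mult_distrib mult.commute mult.left_commute)

text \<open>
  By induction on the list.  The new factor \<open>exp (- l (w \<bullet> x)\<^sup>2 / 2)\<close> is a mixture over a standard
  normal \<open>g\<close> of \<open>cos (sqrt l * g * (w \<bullet> x))\<close>; by the induction hypothesis at
  \<open>u \<plusminus> (sqrt l * g) w\<close> the \<open>x\<close>-integral is the exponential of a quadratic polynomial in \<open>g\<close>, and the
  remaining one-dimensional integral produces the new pivot and the new form.  Nonnegativity of the
  new form is read off from the fact that the integral is largest at \<open>u = 0\<close>.
\<close>

lemma laplace_transform_squares_tilted:
  fixes M :: "'a::euclidean_space measure"
  assumes "has_covariance_form M b" and "\<forall>(l, w)\<in>set ls. 0 \<le> l"
  shows "bilinear (tilted_form b ls) \<and> (\<forall>u v. tilted_form b ls u v = tilted_form b ls v u) \<and>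
     0 < laplace_det b ls \<and> (\<forall>u. 0 \<le> tilted_form b ls u u) \<and>
     (\<forall>u. (\<integral>x. cos (u \<bullet> x) * gauss_weight ls x \<partial>M)
         = exp (- tilted_form b ls u u / 2) / sqrt (laplace_det b ls))"
  using assms(2)
proof (induction ls)
  case Nil
  interpret prob_space M using assms by (simp add: has_covariance_form_def)
  have S [measurable_cong]: "sets M = sets borel" using assms by (simp add: has_covariance_form_def)
  have "0 \<le> b u u" for u
  proof -
    have "(\<integral>x. cos (u \<bullet> x) \<partial>M) \<le> (\<integral>x. 1 \<partial>M)"
      by (intro integral_mono integrable_const_bound[where B=1]) auto
    then show ?thesis using assms by (simp add: has_covariance_form_def prob_space)
  qed
  then show ?case using assms by (simp add: has_covariance_form_def)
next
  case (Cons a ls)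
  obtain l w where a: "a = (l, w)" by (cases a)
  define c where "c = tilted_form b ls"
  define D where "D = laplace_det b ls"
  define d where "d = 1 + l * c w w"
  have l: "0 \<le> l" and ls: "\<forall>(l, w)\<in>set ls. 0 \<le> l" using Cons.prems by (auto simp: a)
  have bil: "bilinear c" and sym: "\<And>u v. c u v = c v u" and D: "D > 0" and pos: "\<And>u. 0 \<le> c u u"
    and lap: "\<And>u. (\<integral>x. cos (u \<bullet> x) * gauss_weight ls x \<partial>M) = exp (- c u u / 2) / sqrt D"
    using Cons.IH[OF ls] by (auto simp: c_def D_def)
  have d: "d \<ge> 1" using l pos[of w] by (simp add: d_def)
  have new: "tilted_form b (a # ls) = (\<lambda>u v. c u v - l * c u w * c v w / d)"
    "laplace_det b (a # ls) = D * d"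
    by (simp_all add: a c_def D_def d_def)
  let ?G = "std_normal_distribution"
  interpret M: prob_space M using assms by (simp add: has_covariance_form_def)
  interpret G: prob_space ?G by (rule prob_space_normal_density) simp
  interpret MG: pair_prob_space M ?G ..
  have S [measurable_cong]: "sets M = sets borel" using assms by (simp add: has_covariance_form_def)
  have bnd: "\<bar>cos p * cos q * gauss_weight ls x\<bar> \<le> 1" for p q x
  proof -
    have "\<bar>cos p\<bar> * \<bar>cos q\<bar> * \<bar>gauss_weight ls x\<bar> \<le> 1 * 1 * 1"
      using gauss_weight_le_1[OF ls, of x] gauss_weight_pos[of ls x] by (intro mult_mono) auto
    then show ?thesis by (simp add: abs_mult)
  qed
  have main: "(\<integral>x. cos (u \<bullet> x) * gauss_weight (a # ls) x \<partial>M)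
      = exp (- (c u u - l * c u w * c u w / d) / 2) / sqrt (D * d)" for u
  proof -
    have int0: "integrable M (\<lambda>x. cos (v \<bullet> x) * gauss_weight ls x)" for v
      using bnd[of _ 0] by (intro M.integrable_const_bound[where B=1]) auto
    have step: "(\<integral>x. cos (u \<bullet> x) * cos (sqrt l * g * (w \<bullet> x)) * gauss_weight ls x \<partial>M)
       = (exp (- (c u u + 2 * (sqrt l * c u w) * g + (l * c w w) * g\<^sup>2) / 2) / sqrt D
        + exp (- (c u u + 2 * (- sqrt l * c u w) * g + (l * c w w) * g\<^sup>2) / 2) / sqrt D) / 2" for g
    proof -
      have "cos (u \<bullet> x) * cos (sqrt l * g * (w \<bullet> x)) * gauss_weight ls x =
         (cos ((u + (sqrt l * g) *\<^sub>R w) \<bullet> x) * gauss_weight ls x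
        + cos ((u + (- (sqrt l * g)) *\<^sub>R w) \<bullet> x) * gauss_weight ls x) / 2" for x
        by (simp add: inner_left_distrib inner_diff_left cos_times_cos algebra_simps add_divide_distrib)
      then have "(\<integral>x. cos (u \<bullet> x) * cos (sqrt l * g * (w \<bullet> x)) * gauss_weight ls x \<partial>M) =
         ((\<integral>x. cos ((u + (sqrt l * g) *\<^sub>R w) \<bullet> x) * gauss_weight ls x \<partial>M)
        + (\<integral>x. cos ((u + (- (sqrt l * g)) *\<^sub>R w) \<bullet> x) * gauss_weight ls x \<partial>M)) / 2"
        by (simp only: integral_divide_zero Bochner_Integration.integral_add[OF int0 int0])
      also have "\<dots> = (exp (- (c u u + 2 * (sqrt l * c u w) * g + (l * c w w) * g\<^sup>2) / 2) / sqrt D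
        + exp (- (c u u + 2 * (- sqrt l * c u w) * g + (l * c w w) * g\<^sup>2) / 2) / sqrt D) / 2"
        unfolding lap quadratic_form_add[OF bil sym] using l
        by (simp add: power_mult_distrib mult.assoc mult.left_commute mult.commute)
      finally show ?thesis .
    qed
    \<comment> \<open>The two exponentials differ by the sign of their linear term, so their integrals agree.\<close>
    have half: "(\<integral>g. exp (- (c u u + 2 * \<beta> * g + (l * c w w) * g\<^sup>2) / 2) / sqrt D \<partial>?G)
       = exp (- (c u u - l * c u w * c u w / d) / 2) / sqrt (D * d)"
      if "\<beta>\<^sup>2 = l * c u w * c u w" for \<beta>
      using integral_exp_quadratic_std_normal[of "l * c w w" "c u u" \<beta>] l pos[of w] that
      by (simp add: d_def real_sqrt_mult)
    have int: "integrable ?G (\<lambda>g. exp (- (c u u + 2 * \<beta> * g + (l * c w w) * g\<^sup>2) / 2) / sqrt D)"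
      if "\<beta>\<^sup>2 = l * c u w * c u w" for \<beta>
    \<comment> \<open>A nonzero Bochner integral can only come from an integrable function.\<close>
    proof (rule ccontr)
      assume "\<not> ?thesis"
      from not_integrable_integral_eq[OF this] half[OF that] D d show False by simp
    qed
    have "(\<integral>x. cos (u \<bullet> x) * gauss_weight (a # ls) x \<partial>M)
        = (\<integral>x. (\<integral>g. cos (u \<bullet> x) * cos (sqrt l * g * (w \<bullet> x)) * gauss_weight ls x \<partial>?G) \<partial>M)"
      using exp_square_eq_integral_cos[OF l] by (simp add: a mult.commute mult.left_commute)
    also have "\<dots> = (\<integral>g. (\<integral>x. cos (u \<bullet> x) * cos (sqrt l * g * (w \<bullet> x)) * gauss_weight ls x \<partial>M) \<partial>?G)"
      by (rule MG.Fubini_integral[symmetric], rule MG.integrable_const_bound[where B=1])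
         (use bnd in auto)
    also have "\<dots> = exp (- (c u u - l * c u w * c u w / d) / 2) / sqrt (D * d)"
      unfolding step using half[of "sqrt l * c u w"] half[of "- sqrt l * c u w"]
        int[of "sqrt l * c u w"] int[of "- sqrt l * c u w"] l
      by (simp add: power_mult_distrib power2_eq_square)
    finally show ?thesis .
  qed
  have "bilinear (tilted_form b (a # ls))"
    using bil unfolding new bilinear_def linear_iff
    by (auto simp: algebra_simps diff_divide_distrib add_divide_distrib)
  moreover have "\<forall>u v. tilted_form b (a # ls) u v = tilted_form b (a # ls) v u"
    unfolding new using sym by (auto simp: algebra_simps)
  moreover have "0 < laplace_det b (a # ls)" unfolding new using D d by simp
  moreover have lap': "\<forall>u. (\<integral>x. cos (u \<bullet> x) * gauss_weight (a # ls) x \<partial>M) =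
      exp (- tilted_form b (a # ls) u u / 2) / sqrt (laplace_det b (a # ls))"
    unfolding new using main by simp
  moreover have "0 \<le> tilted_form b (a # ls) u u" for u
  proof -
    have bnd': "\<bar>cos p * gauss_weight (a # ls) x\<bar> \<le> 1" for p x
    proof -
      have "\<bar>cos p\<bar> * \<bar>gauss_weight (a # ls) x\<bar> \<le> 1 * 1"
        using gauss_weight_le_1[OF Cons.prems, of x] gauss_weight_pos[of "a # ls" x] by (intro mult_mono) auto
      then show ?thesis by (simp only: abs_mult mult_1_left)
    qed
    have int': "integrable M (\<lambda>x. cos (v \<bullet> x) * gauss_weight (a # ls) x)" for v
      using bnd' by (intro M.integrable_const_bound[where B=1]) auto
    have "(\<integral>x. cos (u \<bullet> x) * gauss_weight (a # ls) x \<partial>M) \<le> (\<integral>x. cos (0 \<bullet> x) * gauss_weight (a # ls) x \<partial>M)"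
    proof (rule integral_mono[OF int' int'])
      show "cos (u \<bullet> x) * gauss_weight (a # ls) x \<le> cos (0 \<bullet> x) * gauss_weight (a # ls) x" for x
        using gauss_weight_pos[of "a # ls" x] by (intro mult_right_mono) (auto simp del: gauss_weight_simps)
    qed
    moreover have "tilted_form b (a # ls) 0 0 = 0"
      using \<open>bilinear (tilted_form b (a # ls))\<close> by (rule bilinear_lzero)
    ultimately show ?thesis
      using lap' \<open>0 < laplace_det b (a # ls)\<close> by (simp only: exp_zero) (simp add: divide_le_cancel)
  qed
  ultimately show ?case by blast
qed

section \<open>Two correlated copies\<close>

lemma integral_pair_mult:
  fixes f :: "'a \<Rightarrow> real" and g :: "'b \<Rightarrow> real"
  assumes "prob_space M" "prob_space N"
    and [measurable]: "f \<in> borel_measurable M" "g \<in> borel_measurable N"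
    and "\<And>x. \<bar>f x\<bar> \<le> 1" "\<And>y. \<bar>g y\<bar> \<le> 1"
  shows "(\<integral>z. f (fst z) * g (snd z) \<partial>(M \<Otimes>\<^sub>M N)) = (\<integral>x. f x \<partial>M) * (\<integral>y. g y \<partial>N)"
    and "integrable (M \<Otimes>\<^sub>M N) (\<lambda>z. f (fst z) * g (snd z))"
proof -
  interpret M: prob_space M by fact
  interpret N: prob_space N by fact
  interpret MN: pair_prob_space M N ..
  have "\<bar>f x * g y\<bar> \<le> 1" for x y
    using mult_mono[of "\<bar>f x\<bar>" 1 "\<bar>g y\<bar>" 1] assms(5,6) by (simp add: abs_mult)
  then show int: "integrable (M \<Otimes>\<^sub>M N) (\<lambda>z. f (fst z) * g (snd z))"
    by (intro MN.integrable_const_bound[where B=1]) auto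
  show "(\<integral>z. f (fst z) * g (snd z) \<partial>(M \<Otimes>\<^sub>M N)) = (\<integral>x. f x \<partial>M) * (\<integral>y. g y \<partial>N)"
    using MN.integral_fst'[OF int] by simp
qed

text \<open>
  The weight is the characteristic function of the Gaussian vector \<open>\<Sum>i. (sqrt l\<^sub>i * g\<^sub>i) w\<^sub>i\<close> with
  independent standard normal \<open>g\<^sub>i\<close>.  The law \<open>N\<close> is built by adding one summand at a time; the
  sine integral is carried along because the addition theorem mixes both.
\<close>

lemma gauss_weight_cosine_mixture:
  fixes ls :: "(real \<times> 'a::euclidean_space) list"
  assumes "\<forall>(l, w)\<in>set ls. 0 \<le> l"
  shows "\<exists>N :: 'a measure. prob_space N \<and> sets N = sets borel \<and>
    (\<forall>x. (\<integral>a. cos (a \<bullet> x) \<partial>N) = gauss_weight ls x) \<and> (\<forall>x. (\<integral>a. sin (a \<bullet> x) \<partial>N) = 0)"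
  using assms
proof (induction ls)
  case Nil
  show ?case
    by (rule exI[of _ "return borel 0"]) (auto simp: integral_return intro!: prob_space_return)
next
  case (Cons p ls)
  obtain l w where p: "p = (l, w)" by (cases p)
  have l: "0 \<le> l" using Cons.prems p by simp
  from Cons obtain N :: "'a measure" where P: "prob_space N" and S [measurable_cong]: "sets N = sets borel"
    and c: "\<And>x. (\<integral>a. cos (a \<bullet> x) \<partial>N) = gauss_weight ls x" and s: "\<And>x. (\<integral>a. sin (a \<bullet> x) \<partial>N) = 0"
    by auto
  let ?G = "std_normal_distribution"
  have G: "prob_space ?G" by (rule prob_space_normal_density) simp
  interpret N: prob_space N by (rule P)
  interpret G: prob_space ?G by (rule G)
  interpret NG: pair_prob_space N ?G ..
  let ?T = "\<lambda>z::'a \<times> real. fst z + (sqrt l * snd z) *\<^sub>R w"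
  have T [measurable]: "?T \<in> measurable (N \<Otimes>\<^sub>M ?G) borel" by measurable
  let ?N = "distr (N \<Otimes>\<^sub>M ?G) borel ?T"
  note prod = integral_pair_mult[OF P G]
  have c': "(\<integral>g. cos (sqrt l * (w \<bullet> x) * g) \<partial>?G) = exp (- l * (w \<bullet> x)\<^sup>2 / 2)" for x
    using exp_square_eq_integral_cos[OF l, of "w \<bullet> x"] by (simp add: mult.commute mult.left_commute)
  have "(\<integral>a. cos (a \<bullet> x) \<partial>?N) = gauss_weight (p # ls) x" for x
  proof -
    have "(\<integral>a. cos (a \<bullet> x) \<partial>?N) = (\<integral>z. cos (fst z \<bullet> x) * cos (sqrt l * (w \<bullet> x) * snd z)
        - sin (fst z \<bullet> x) * sin (sqrt l * (w \<bullet> x) * snd z) \<partial>(N \<Otimes>\<^sub>M ?G))"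
      by (subst integral_distr) (auto simp: inner_left_distrib cos_add ac_simps)
    also have "\<dots> = gauss_weight (p # ls) x"
      using prod[of "\<lambda>a. cos (a \<bullet> x)" "\<lambda>g. cos (sqrt l * (w \<bullet> x) * g)"]
        prod[of "\<lambda>a. sin (a \<bullet> x)" "\<lambda>g. sin (sqrt l * (w \<bullet> x) * g)"]
      by (simp add: c c' s p)
    finally show ?thesis .
  qed
  moreover have "(\<integral>a. sin (a \<bullet> x) \<partial>?N) = 0" for x
  proof -
    have "(\<integral>a. sin (a \<bullet> x) \<partial>?N) = (\<integral>z. sin (fst z \<bullet> x) * cos (sqrt l * (w \<bullet> x) * snd z)
        + cos (fst z \<bullet> x) * sin (sqrt l * (w \<bullet> x) * snd z) \<partial>(N \<Otimes>\<^sub>M ?G))"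
      by (subst integral_distr) (auto simp: inner_left_distrib sin_add ac_simps)
    also have "\<dots> = 0"
      using prod[of "\<lambda>a. sin (a \<bullet> x)" "\<lambda>g. cos (sqrt l * (w \<bullet> x) * g)"]
        prod[of "\<lambda>a. cos (a \<bullet> x)" "\<lambda>g. sin (sqrt l * (w \<bullet> x) * g)"]
      by (simp add: s integral_sin_std_normal)
    finally show ?thesis .
  qed
  ultimately show ?case
    by (intro exI[of _ ?N]) (auto intro!: NG.prob_space_distr)
qed

text \<open>
  The joint law of \<open>(X, \<tau> X + sqrt (1 - \<tau>\<^sup>2) Y)\<close> for independent \<open>X\<close> and \<open>Y\<close> with law \<open>M\<close>.  For a
  centered Gaussian \<open>M\<close> both components have law \<open>M\<close>, and the parameter scales only the covariance
  between them.
\<close>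

definition correlated_copies :: "'a::euclidean_space measure \<Rightarrow> real \<Rightarrow> ('a \<times> 'a) measure" where
  "correlated_copies M \<tau> = distr (M \<Otimes>\<^sub>M M) borel (\<lambda>z. (fst z, \<tau> *\<^sub>R fst z + sqrt (1 - \<tau>\<^sup>2) *\<^sub>R snd z))"

definition correlated_form :: "('a \<Rightarrow> 'a \<Rightarrow> real) \<Rightarrow> real \<Rightarrow> 'a \<times> 'a \<Rightarrow> 'a \<times> 'a \<Rightarrow> real" where
  "correlated_form b \<tau> p q =
     b (fst p) (fst q) + b (snd p) (snd q) + \<tau> * (b (fst p) (snd q) + b (snd p) (fst q))"

lemma correlated_copies_measurable:
  fixes M :: "'a::euclidean_space measure"
  assumes [measurable_cong]: "sets M = sets borel"
  shows "(\<lambda>z. (fst z, \<tau> *\<^sub>R fst z + c *\<^sub>R snd z)) \<in> measurable (M \<Otimes>\<^sub>M M) borel"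
  unfolding borel_prod[symmetric] by measurable

text \<open>
  By the addition theorem the integral factors into integrals over the two independent copies; the
  sine terms vanish, and the quadratic terms in the second component add up because
  \<open>\<tau>\<^sup>2 + (1 - \<tau>\<^sup>2) = 1\<close>.
\<close>

lemma correlated_copies_covariance:
  fixes M :: "'a::euclidean_space measure"
  assumes "has_covariance_form M b" and s: "\<And>u. (\<integral>x. sin (u \<bullet> x) \<partial>M) = 0" and "\<bar>\<tau>\<bar> \<le> 1"
  shows "has_covariance_form (correlated_copies M \<tau>) (correlated_form b \<tau>)"
proof -
  have P: "prob_space M" and S [measurable_cong]: "sets M = sets borel" and bil: "bilinear b"
    and sym: "\<And>u v. b u v = b v u" and c: "\<And>u. (\<integral>x. cos (u \<bullet> x) \<partial>M) = exp (- b u u / 2)"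
    using assms(1) by (auto simp: has_covariance_form_def)
  interpret prob_space M by (rule P)
  interpret MM: pair_prob_space M M ..
  note m = correlated_copies_measurable[OF S]
  note prod = integral_pair_mult[OF P P]
  have \<tau>: "1 - \<tau>\<^sup>2 \<ge> 0" using assms(3) by (simp add: abs_square_le_1)
  have "(\<integral>z. cos (u \<bullet> z) \<partial>correlated_copies M \<tau>) = exp (- correlated_form b \<tau> u u / 2)" for u
  proof -
    obtain a d where u: "u = (a, d)" by (cases u)
    let ?e = "sqrt (1 - \<tau>\<^sup>2) *\<^sub>R d"
    have "(\<integral>z. cos (u \<bullet> z) \<partial>correlated_copies M \<tau>)
      = (\<integral>z. cos ((a + \<tau> *\<^sub>R d) \<bullet> fst z) * cos (?e \<bullet> snd z) - sin ((a + \<tau> *\<^sub>R d) \<bullet> fst z) * sin (?e \<bullet> snd z) \<partial>(M \<Otimes>\<^sub>M M))"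
    proof -
      have "u \<bullet> (x, \<tau> *\<^sub>R x + sqrt (1 - \<tau>\<^sup>2) *\<^sub>R y) = (a + \<tau> *\<^sub>R d) \<bullet> x + ?e \<bullet> y" for x y
        by (simp add: u inner_left_distrib inner_right_distrib)
      then show ?thesis
        unfolding correlated_copies_def by (subst integral_distr[OF m]) (simp_all only: cos_add, measurable)
    qed
    also have "\<dots> = exp (- b (a + \<tau> *\<^sub>R d) (a + \<tau> *\<^sub>R d) / 2) * exp (- b ?e ?e / 2)"
      using prod[of "\<lambda>x. cos ((a + \<tau> *\<^sub>R d) \<bullet> x)" "\<lambda>x. cos (?e \<bullet> x)"]
        prod[of "\<lambda>x. sin ((a + \<tau> *\<^sub>R d) \<bullet> x)" "\<lambda>x. sin (?e \<bullet> x)"]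
      by (simp only: Bochner_Integration.integral_diff c s) simp
    also have "\<dots> = exp (- (b a a + 2 * \<tau> * b a d + \<tau>\<^sup>2 * b d d) / 2 - (1 - \<tau>\<^sup>2) * b d d / 2)"
      using \<tau> by (simp add: quadratic_form_add[OF bil sym] bilinear_lmul[OF bil] bilinear_rmul[OF bil] flip: exp_add mult.assoc)
    also have "\<dots> = exp (- correlated_form b \<tau> u u / 2)"
      using sym[of a d] by (simp add: u correlated_form_def field_simps)
    finally show ?thesis .
  qed
  moreover have "bilinear (correlated_form b \<tau>)"
    using bil unfolding bilinear_def linear_iff correlated_form_def by (auto simp: algebra_simps)
  moreover have "prob_space (correlated_copies M \<tau>)" "sets (correlated_copies M \<tau>) = sets borel"
    unfolding correlated_copies_def using m by (auto intro: MM.prob_space_distr)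
  ultimately show ?thesis
    using sym by (auto simp: has_covariance_form_def correlated_form_def)
qed

text \<open>
  Writing both weights as mixtures of cosines reduces the claim to
  \<open>E (cos (a \<bullet> X) cos (c \<bullet> X\<^sub>\<tau>)) = exp (- (b a a + b c c) / 2) cosh (\<tau> b a c)\<close>, and \<open>cosh\<close> increases
  with the absolute value of its argument.
\<close>

lemma correlated_laplace_mono:
  fixes M :: "'a::euclidean_space measure" and ls ks :: "(real \<times> 'a) list"
  assumes M: "has_covariance_form M b" "\<And>u. (\<integral>x. sin (u \<bullet> x) \<partial>M) = 0"
    and \<tau>: "0 \<le> s" "s \<le> t" "t \<le> 1"
    and ls: "\<forall>(l, w)\<in>set ls. 0 \<le> l" and ks: "\<forall>(l, w)\<in>set ks. 0 \<le> l"
  shows "(\<integral>z. gauss_weight ls (fst z) * gauss_weight ks (snd z) \<partial>correlated_copies M s)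
    \<le> (\<integral>z. gauss_weight ls (fst z) * gauss_weight ks (snd z) \<partial>correlated_copies M t)"
proof -
  have bil: "bilinear b" and sym: "\<And>u v. b u v = b v u"
    using M(1) by (auto simp: has_covariance_form_def)
  obtain A :: "'a measure" where A: "prob_space A" and SA [measurable_cong]: "sets A = sets borel"
    and cA: "\<And>x. (\<integral>a. cos (a \<bullet> x) \<partial>A) = gauss_weight ls x"
    using gauss_weight_cosine_mixture[OF ls] by auto
  obtain C :: "'a measure" where C: "prob_space C" and SC [measurable_cong]: "sets C = sets borel"
    and cC: "\<And>x. (\<integral>a. cos (a \<bullet> x) \<partial>C) = gauss_weight ks x"
    using gauss_weight_cosine_mixture[OF ks] by auto
  interpret A: prob_space A by (rule A)
  interpret C: prob_space C by (rule C)
  interpret AC: pair_prob_space A C ..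
  define h where "h \<tau> p = exp (- (b (fst p) (fst p) + b (snd p) (snd p)) / 2) * cosh (\<tau> * b (fst p) (snd p))"
    for \<tau> p
  have eq: "(\<integral>z. gauss_weight ls (fst z) * gauss_weight ks (snd z) \<partial>correlated_copies M \<tau>)
      = (\<integral>p. h \<tau> p \<partial>(A \<Otimes>\<^sub>M C))" and int: "integrable (A \<Otimes>\<^sub>M C) (h \<tau>)" if "\<bar>\<tau>\<bar> \<le> 1" for \<tau>
  proof -
    let ?N = "correlated_copies M \<tau>"
    have N: "has_covariance_form ?N (correlated_form b \<tau>)"
      using correlated_copies_covariance[OF M that] .
    then have SN: "sets ?N = sets borel" and cos_N: "\<And>u. (\<integral>x. cos (u \<bullet> x) \<partial>?N) = exp (- correlated_form b \<tau> u u / 2)"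
      by (auto simp: has_covariance_form_def)
    have SN' [measurable_cong]: "sets ?N = sets (borel \<Otimes>\<^sub>M borel)" unfolding SN borel_prod ..
    interpret N: prob_space ?N using N by (simp add: has_covariance_form_def)
    interpret ACN: pair_prob_space "A \<Otimes>\<^sub>M C" ?N ..
    have bnd: "\<bar>cos p * cos q\<bar> \<le> (1::real)" for p q :: real
      using mult_mono[of "\<bar>cos p\<bar>" 1 "\<bar>cos q\<bar>" 1] by (simp add: abs_mult)
    have intN: "integrable ?N (\<lambda>z. cos (u \<bullet> z))" for u
    proof (rule N.integrable_const_bound[where B=1])
      show "(\<lambda>z. cos (u \<bullet> z)) \<in> borel_measurable ?N"
        unfolding measurable_cong_sets[OF SN refl] by measurable
    qed auto
    have hN: "(\<integral>z. cos (fst p \<bullet> fst z) * cos (snd p \<bullet> snd z) \<partial>?N) = h \<tau> p" for p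
    proof -
      have "cos (fst p \<bullet> fst z) * cos (snd p \<bullet> snd z) = (cos ((fst p, - snd p) \<bullet> z) + cos (p \<bullet> z)) / 2" for z
        by (cases p; cases z) (simp add: cos_times_cos)
      then have "(\<integral>z. cos (fst p \<bullet> fst z) * cos (snd p \<bullet> snd z) \<partial>?N)
        = (exp (- correlated_form b \<tau> (fst p, - snd p) (fst p, - snd p) / 2) + exp (- correlated_form b \<tau> p p / 2)) / 2"
        by (simp only: integral_divide_zero Bochner_Integration.integral_add[OF intN intN] cos_N)
      also have "\<dots> = h \<tau> p"
        using sym[of "fst p" "snd p"]
        by (simp add: h_def correlated_form_def cosh_field_def bilinear_lneg[OF bil] bilinear_rneg[OF bil]
            field_simps flip: exp_add)
      finally show ?thesis .
    qed
    have intACN: "integrable ((A \<Otimes>\<^sub>M C) \<Otimes>\<^sub>M ?N) (\<lambda>(p, z). cos (fst p \<bullet> fst z) * cos (snd p \<bullet> snd z))"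
      by (rule ACN.integrable_const_bound[where B=1]) (use bnd in auto)
    show "integrable (A \<Otimes>\<^sub>M C) (h \<tau>)"
      using ACN.integrable_fst'[OF intACN] by (simp add: hN)
    have "(\<integral>z. gauss_weight ls (fst z) * gauss_weight ks (snd z) \<partial>?N)
      = (\<integral>z. (\<integral>p. cos (fst p \<bullet> fst z) * cos (snd p \<bullet> snd z) \<partial>(A \<Otimes>\<^sub>M C)) \<partial>?N)"
      by (simp add: integral_pair_mult(1)[OF A C, of "\<lambda>a. cos (a \<bullet> _)" "\<lambda>a. cos (a \<bullet> _)"] cA cC)
    also have "\<dots> = (\<integral>p. h \<tau> p \<partial>(A \<Otimes>\<^sub>M C))"
      using ACN.Fubini_integral[OF intACN] by (simp add: hN)
    finally show "(\<integral>z. gauss_weight ls (fst z) * gauss_weight ks (snd z) \<partial>?N) = (\<integral>p. h \<tau> p \<partial>(A \<Otimes>\<^sub>M C))" .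
  qed
  have "h s p \<le> h t p" for p
  proof -
    have "cosh \<bar>s * b (fst p) (snd p)\<bar> \<le> cosh \<bar>t * b (fst p) (snd p)\<bar>"
      using \<tau> by (subst cosh_real_nonneg_le_iff) (auto simp: abs_mult intro: mult_right_mono)
    then show ?thesis unfolding h_def by (intro mult_left_mono) auto
  qed
  then show ?thesis
    using \<tau> by (simp add: eq, intro integral_mono int) auto
qed

section \<open>Multi-affine functions on the orthant\<close>

text \<open>
  A function \<open>A + t B\<close> that is nonnegative for all \<open>t \<ge> 0\<close> has \<open>A \<ge> 0\<close> and \<open>B \<ge> 0\<close>.  Applied to one
  variable, with all others held fixed, this shows that both the part without that variable and its
  cofactor are nonnegative on the orthant, and both are affine in the remaining variables, so
  induction applies to each.  The hypotheses are stated on the whole orthant and the variables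
  outside \<open>I\<close> are set to 0, so that the induction can eliminate a variable by setting it to a value.
\<close>

lemma multiaffine_nonneg_coefficients:
  fixes f :: "('i \<Rightarrow> real) \<Rightarrow> real"
  assumes "finite I"
    and "\<And>\<theta> i t. (\<forall>j. 0 \<le> \<theta> j) \<Longrightarrow> i \<in> I \<Longrightarrow> 0 \<le> t \<Longrightarrow>
      f (\<theta>(i := t)) = (1 - t) * f (\<theta>(i := 0)) + t * f (\<theta>(i := 1))"
    and "\<And>\<theta>. (\<forall>j. 0 \<le> \<theta> j) \<Longrightarrow> 0 \<le> f \<theta>"
  shows "\<exists>g. (\<forall>J. 0 \<le> g J) \<and> (\<forall>\<theta>. (\<forall>j. 0 \<le> \<theta> j) \<longrightarrow> (\<forall>j. j \<notin> I \<longrightarrow> \<theta> j = 0) \<longrightarrow>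
    f \<theta> = (\<Sum>J\<in>Pow I. g J * (\<Prod>j\<in>J. \<theta> j)))"
  using assms
proof (induction I arbitrary: f rule: finite_induct)
  case empty
  have const: "f \<theta> = (\<Sum>J\<in>Pow {}. f (\<lambda>_. 0) * (\<Prod>j\<in>J. \<theta> j))" if "\<forall>j. j \<notin> {} \<longrightarrow> \<theta> j = 0" for \<theta>
  proof -
    have "\<theta> = (\<lambda>_. 0)" using that by auto
    then show ?thesis by simp
  qed
  have "0 \<le> f (\<lambda>_. 0)" by (rule empty.prems(2)) simp
  then show ?case
    by (intro exI[of _ "\<lambda>_. f (\<lambda>_. 0)"] conjI allI impI const) simp_all
next
  case (insert i I)
  define f0 where "f0 \<theta> = f (\<theta>(i := 0))" for \<theta>
  define f1 where "f1 \<theta> = f (\<theta>(i := 1)) - f (\<theta>(i := 0))" for \<theta>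
  have split: "f (\<theta>(i := t)) = f0 \<theta> + t * f1 \<theta>" if "\<forall>j. 0 \<le> \<theta> j" "0 \<le> t" for \<theta> t
  proof -
    have "f (\<theta>(i := t)) = (1 - t) * f (\<theta>(i := 0)) + t * f (\<theta>(i := 1))"
      by (rule insert.prems(1)) (use that in auto)
    then show ?thesis unfolding f0_def f1_def by argo
  qed
  have aff: "f ((\<theta>(j := t))(i := e)) = (1 - t) * f ((\<theta>(j := 0))(i := e)) + t * f ((\<theta>(j := 1))(i := e))"
    if "\<forall>j. 0 \<le> \<theta> j" "j \<in> I" "0 \<le> t" "0 \<le> e" for \<theta> j t e
  proof -
    have ne: "j \<noteq> i" using that(2) insert.hyps by auto
    show ?thesis
      unfolding fun_upd_twist[OF ne] by (rule insert.prems(1)) (use that in auto)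
  qed
  have f0_nonneg: "0 \<le> f0 \<theta>" if "\<forall>j. 0 \<le> \<theta> j" for \<theta>
    unfolding f0_def using that by (intro insert.prems(2)) auto
  have f1_nonneg: "0 \<le> f1 \<theta>" if "\<forall>j. 0 \<le> \<theta> j" for \<theta>
  proof (rule ccontr)
    assume neg: "\<not> 0 \<le> f1 \<theta>"
    \<comment> \<open>With a negative slope the affine function takes the value -1 at this point.\<close>
    define t where "t = (f0 \<theta> + 1) / (- f1 \<theta>)"
    have t: "0 \<le> t" unfolding t_def using neg f0_nonneg[OF that] by (intro divide_nonneg_pos) auto
    have "f0 \<theta> + t * f1 \<theta> = - 1" using neg by (simp add: t_def field_simps)
    moreover have "0 \<le> f (\<theta>(i := t))" using that t by (intro insert.prems(2)) auto
    ultimately show False using split[OF that t] by simp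
  qed
  have "\<exists>g. (\<forall>J. 0 \<le> g J) \<and> (\<forall>\<theta>. (\<forall>j. 0 \<le> \<theta> j) \<longrightarrow> (\<forall>j. j \<notin> I \<longrightarrow> \<theta> j = 0) \<longrightarrow>
      f0 \<theta> = (\<Sum>J\<in>Pow I. g J * (\<Prod>j\<in>J. \<theta> j)))"
  proof (rule insert.IH[OF _ f0_nonneg])
    show "f0 (\<theta>(j := t)) = (1 - t) * f0 (\<theta>(j := 0)) + t * f0 (\<theta>(j := 1))"
      if "\<forall>j. 0 \<le> \<theta> j" "j \<in> I" "0 \<le> t" for \<theta> j t
      unfolding f0_def by (rule aff) (use that in auto)
  qed
  then obtain g0 where g0: "\<And>J. 0 \<le> g0 J"
    "\<And>\<theta>. \<forall>j. 0 \<le> \<theta> j \<Longrightarrow> \<forall>j. j \<notin> I \<longrightarrow> \<theta> j = 0 \<Longrightarrow> f0 \<theta> = (\<Sum>J\<in>Pow I. g0 J * (\<Prod>j\<in>J. \<theta> j))"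
    by blast
  have "\<exists>g. (\<forall>J. 0 \<le> g J) \<and> (\<forall>\<theta>. (\<forall>j. 0 \<le> \<theta> j) \<longrightarrow> (\<forall>j. j \<notin> I \<longrightarrow> \<theta> j = 0) \<longrightarrow>
      f1 \<theta> = (\<Sum>J\<in>Pow I. g J * (\<Prod>j\<in>J. \<theta> j)))"
  proof (rule insert.IH[OF _ f1_nonneg])
    show "f1 (\<theta>(j := t)) = (1 - t) * f1 (\<theta>(j := 0)) + t * f1 (\<theta>(j := 1))"
      if "\<forall>j. 0 \<le> \<theta> j" "j \<in> I" "0 \<le> t" for \<theta> j t
      using aff[of \<theta> j t 0] aff[of \<theta> j t 1] that
      by (simp add: f1_def algebra_simps del: fun_upd_apply)
  qed
  then obtain g1 where g1: "\<And>J. 0 \<le> g1 J"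
    "\<And>\<theta>. \<forall>j. 0 \<le> \<theta> j \<Longrightarrow> \<forall>j. j \<notin> I \<longrightarrow> \<theta> j = 0 \<Longrightarrow> f1 \<theta> = (\<Sum>J\<in>Pow I. g1 J * (\<Prod>j\<in>J. \<theta> j))"
    by blast
  define g where "g J = (if i \<in> J then g1 (J - {i}) else g0 J)" for J
  have "f \<theta> = (\<Sum>J\<in>Pow (insert i I). g J * (\<Prod>j\<in>J. \<theta> j))"
    if pos: "\<forall>j. 0 \<le> \<theta> j" and supp: "\<forall>j. j \<notin> insert i I \<longrightarrow> \<theta> j = 0" for \<theta>
  proof -
    let ?m = "\<theta>(i := 0)"
    have m: "\<forall>j. 0 \<le> ?m j" "\<forall>j. j \<notin> I \<longrightarrow> ?m j = 0" using pos supp by auto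
    have prod_m: "(\<Prod>j\<in>J. ?m j) = (\<Prod>j\<in>J. \<theta> j)" if "J \<subseteq> I" for J
      using that insert.hyps by (intro prod.cong) auto
    have "f \<theta> = f0 ?m + \<theta> i * f1 ?m"
    proof -
      have "f (?m(i := \<theta> i)) = f0 ?m + \<theta> i * f1 ?m" by (rule split) (use pos in auto)
      moreover have "?m(i := \<theta> i) = \<theta>" by simp
      ultimately show ?thesis by (simp only:)
    qed
    also have "\<dots> = (\<Sum>J\<in>Pow I. g0 J * (\<Prod>j\<in>J. \<theta> j)) + (\<Sum>J\<in>Pow I. g1 J * (\<theta> i * (\<Prod>j\<in>J. \<theta> j)))"
      unfolding g0(2)[OF m] g1(2)[OF m] sum_distrib_left
      by (intro arg_cong2[of _ _ _ _ "(+)"] sum.cong refl) (simp_all add: prod_m del: fun_upd_apply)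
    also have "(\<Sum>J\<in>Pow I. g0 J * (\<Prod>j\<in>J. \<theta> j)) = (\<Sum>J\<in>Pow I. g J * (\<Prod>j\<in>J. \<theta> j))"
      using insert.hyps by (intro sum.cong) (auto simp: g_def)
    also have "(\<Sum>J\<in>Pow I. g1 J * (\<theta> i * (\<Prod>j\<in>J. \<theta> j))) = (\<Sum>J\<in>insert i ` Pow I. g J * (\<Prod>j\<in>J. \<theta> j))"
    proof (subst sum.reindex)
      show "inj_on (insert i) (Pow I)" using insert.hyps by (auto simp: inj_on_def)
      show "(\<Sum>J\<in>Pow I. g1 J * (\<theta> i * (\<Prod>j\<in>J. \<theta> j))) = sum ((\<lambda>J. g J * (\<Prod>j\<in>J. \<theta> j)) \<circ> insert i) (Pow I)"
      proof (intro sum.cong refl)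
        fix J assume J: "J \<in> Pow I"
        then have "i \<notin> J" "finite J" using insert.hyps finite_subset by auto
        then show "g1 J * (\<theta> i * (\<Prod>j\<in>J. \<theta> j)) = ((\<lambda>J. g J * (\<Prod>j\<in>J. \<theta> j)) \<circ> insert i) J"
          by (simp add: g_def)
      qed
    qed
    also have "(\<Sum>J\<in>Pow I. g J * (\<Prod>j\<in>J. \<theta> j)) + (\<Sum>J\<in>insert i ` Pow I. g J * (\<Prod>j\<in>J. \<theta> j))
      = (\<Sum>J\<in>Pow (insert i I). g J * (\<Prod>j\<in>J. \<theta> j))"
      unfolding Pow_insert using insert.hyps by (subst sum.union_disjoint) auto
    finally show ?thesis .
  qed
  moreover have "0 \<le> g J" for J using g0(1) g1(1) by (simp add: g_def)
  ultimately show ?case by blast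
qed

section \<open>The determinant decreases with the correlation\<close>

text \<open>
  The only divisions in the recursion are by \<open>1 + l * c w w\<close> with \<open>c\<close> a tilted form, and these
  pivots are at least 1 as long as all tilted forms are nonnegative at the point in question.
\<close>

lemma laplace_det_differentiable:
  fixes b :: "real \<Rightarrow> 'a \<Rightarrow> 'a \<Rightarrow> real"
  assumes b: "\<And>u v. (\<lambda>\<tau>. b \<tau> u v) differentiable (at \<tau>0)"
    and pos: "\<And>ls u. \<forall>(l, w)\<in>set ls. 0 \<le> l \<Longrightarrow> 0 \<le> tilted_form (b \<tau>0) ls u u"
    and ls: "\<forall>(l, w)\<in>set ls. 0 \<le> l"
  shows "(\<forall>u v. (\<lambda>\<tau>. tilted_form (b \<tau>) ls u v) differentiable (at \<tau>0)) \<and>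
    (\<lambda>\<tau>. laplace_det (b \<tau>) ls) differentiable (at \<tau>0)"
  using ls
proof (induction ls)
  case Nil
  then show ?case using b by simp
next
  case (Cons a ls)
  obtain l w where a: "a = (l, w)" by (cases a)
  have ls: "\<forall>(l, w)\<in>set ls. 0 \<le> l" and l: "0 \<le> l" using Cons.prems a by auto
  have IH: "(\<lambda>\<tau>. tilted_form (b \<tau>) ls u v) differentiable (at \<tau>0)"
    "(\<lambda>\<tau>. laplace_det (b \<tau>) ls) differentiable (at \<tau>0)" for u v
    using Cons.IH[OF ls] by auto
  have "0 \<le> l * tilted_form (b \<tau>0) ls w w" using pos[OF ls, of w] l by simp
  then have "1 + l * tilted_form (b \<tau>0) ls w w \<noteq> 0" by linarith
  then show ?case
    unfolding a tilted_form.simps laplace_det.simps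
    by (intro conjI allI differentiable_diff differentiable_divide differentiable_mult
        differentiable_add differentiable_const IH)
qed

text \<open>
  A finite family of functionals on the product space, each depending on one of the two components
  only; the functionals of the first kind describe \<open>K\<close> and those of the second kind \<open>L\<close>.
\<close>

locale correlated_blocks =
  fixes M :: "'a::euclidean_space measure" and b :: "'a \<Rightarrow> 'a \<Rightarrow> real"
    and I :: "'i set" and w :: "'i \<Rightarrow> 'a \<times> 'a"
  assumes covariance: "has_covariance_form M b" and sin_integral: "\<And>u. (\<integral>x. sin (u \<bullet> x) \<partial>M) = 0"
    and finite_I: "finite I" and one_block: "\<And>i. i \<in> I \<Longrightarrow> fst (w i) = 0 \<or> snd (w i) = 0"
begin

definition laplace :: "real \<Rightarrow> ('i \<Rightarrow> real) \<Rightarrow> real" where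
  "laplace \<tau> \<theta> = (\<integral>z. (\<Prod>i\<in>I. exp (- \<theta> i * (w i \<bullet> z)\<^sup>2 / 2)) \<partial>correlated_copies M \<tau>)"

text \<open>
  The recursive determinant needs an ordering of \<open>I\<close>.  Its value does not depend on the ordering,
  since it is recovered from the Laplace transform, but different orderings exhibit different
  properties of it.
\<close>

definition cov_det_list :: "'i list \<Rightarrow> real \<Rightarrow> ('i \<Rightarrow> real) \<Rightarrow> real" where
  "cov_det_list xs \<tau> \<theta> = laplace_det (correlated_form b \<tau>) (map (\<lambda>i. (\<theta> i, w i)) xs)"

lemma covariance_copies:
  "\<bar>\<tau>\<bar> \<le> 1 \<Longrightarrow> has_covariance_form (correlated_copies M \<tau>) (correlated_form b \<tau>)"
  by (rule correlated_copies_covariance[OF covariance sin_integral])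

lemma gauss_weight_map:
  "distinct xs \<Longrightarrow> gauss_weight (map (\<lambda>i. (\<theta> i, v i)) xs) z = (\<Prod>i\<in>set xs. exp (- \<theta> i * (v i \<bullet> z)\<^sup>2 / 2))"
  by (simp add: gauss_weight_def prod.distinct_set_conv_list o_def)

lemma cov_det_list_laplace:
  assumes "distinct xs" "set xs = I" "\<bar>\<tau>\<bar> \<le> 1" "\<forall>i. 0 \<le> \<theta> i"
  shows "0 < cov_det_list xs \<tau> \<theta>" and "laplace \<tau> \<theta> = 1 / sqrt (cov_det_list xs \<tau> \<theta>)"
proof -
  have ls: "\<forall>(l, w)\<in>set (map (\<lambda>i. (\<theta> i, w i)) xs). 0 \<le> l" using assms(4) by auto
  note L = laplace_transform_squares_tilted[OF covariance_copies[OF assms(3)] ls]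
  show "0 < cov_det_list xs \<tau> \<theta>" using L by (simp add: cov_det_list_def)
  have "(\<integral>z. cos (0 \<bullet> z) * gauss_weight (map (\<lambda>i. (\<theta> i, w i)) xs) z \<partial>correlated_copies M \<tau>)
      = 1 / sqrt (cov_det_list xs \<tau> \<theta>)"
    using L bilinear_lzero by (metis cov_det_list_def div_0 exp_zero minus_zero)
  then show "laplace \<tau> \<theta> = 1 / sqrt (cov_det_list xs \<tau> \<theta>)"
    using assms(1,2) by (simp add: laplace_def gauss_weight_map)
qed

definition cov_det :: "real \<Rightarrow> ('i \<Rightarrow> real) \<Rightarrow> real" where
  "cov_det = cov_det_list (SOME xs. distinct xs \<and> set xs = I)"

lemma cov_det_some: "\<exists>xs. distinct xs \<and> set xs = I \<and> cov_det = cov_det_list xs"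
proof -
  have "\<exists>xs. distinct xs \<and> set xs = I" using finite_distinct_list[OF finite_I] by auto
  from someI_ex[OF this] show ?thesis unfolding cov_det_def by blast
qed

lemma cov_det_pos: "\<bar>\<tau>\<bar> \<le> 1 \<Longrightarrow> \<forall>i. 0 \<le> \<theta> i \<Longrightarrow> 0 < cov_det \<tau> \<theta>"
  using cov_det_some cov_det_list_laplace(1) by metis

lemma laplace_eq: "\<bar>\<tau>\<bar> \<le> 1 \<Longrightarrow> \<forall>i. 0 \<le> \<theta> i \<Longrightarrow> laplace \<tau> \<theta> = 1 / sqrt (cov_det \<tau> \<theta>)"
  using cov_det_some cov_det_list_laplace(2) by metis

lemma cov_det_cong: "(\<And>i. i \<in> I \<Longrightarrow> \<theta> i = \<theta>' i) \<Longrightarrow> cov_det \<tau> \<theta> = cov_det \<tau> \<theta>'"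
  using cov_det_some by (auto simp: cov_det_list_def intro!: arg_cong[of _ _ "laplace_det _"])

text \<open>
  The determinant may be computed with \<open>i\<close> at the head of the list, and there the parameter \<open>\<theta> i\<close>
  enters only through the last pivot.
\<close>

lemma cov_det_affine:
  assumes "\<bar>\<tau>\<bar> \<le> 1" "\<forall>i. 0 \<le> \<theta> i" "i \<in> I" "0 \<le> t"
  shows "cov_det \<tau> (\<theta>(i := t)) = (1 - t) * cov_det \<tau> (\<theta>(i := 0)) + t * cov_det \<tau> (\<theta>(i := 1))"
proof -
  obtain ys where ys: "distinct ys" "set ys = I - {i}"
    using finite_distinct_list[of "I - {i}"] finite_I by auto
  let ?d = "laplace_det (correlated_form b \<tau>) (map (\<lambda>j. (\<theta> j, w j)) ys)"
  let ?c = "tilted_form (correlated_form b \<tau>) (map (\<lambda>j. (\<theta> j, w j)) ys) (w i) (w i)"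
  have "cov_det \<tau> (\<theta>(i := e)) = ?d * (1 + e * ?c)" if "0 \<le> e" for e
  proof -
    have e: "\<forall>j. 0 \<le> (\<theta>(i := e)) j" using assms(2) that by simp
    have iys: "distinct (i # ys)" "set (i # ys) = I" using ys assms(3) by auto
    have "1 / sqrt (cov_det \<tau> (\<theta>(i := e))) = 1 / sqrt (cov_det_list (i # ys) \<tau> (\<theta>(i := e)))"
      using laplace_eq[OF assms(1), of "\<theta>(i := e)"] cov_det_list_laplace(2)[OF iys assms(1), of "\<theta>(i := e)"] e
      by simp
    then have "cov_det \<tau> (\<theta>(i := e)) = cov_det_list (i # ys) \<tau> (\<theta>(i := e))"
      by simp
    moreover have "map (\<lambda>j. ((\<theta>(i := e)) j, w j)) ys = map (\<lambda>j. (\<theta> j, w j)) ys"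
      using ys by auto
    ultimately show ?thesis by (simp only: cov_det_list_def list.map laplace_det.simps fun_upd_same)
  qed
  from this[of t] this[of 0] this[of 1] assms(4) show ?thesis by (simp add: algebra_simps)
qed

lemma cov_det_differentiable:
  assumes "\<bar>\<tau>\<bar> \<le> 1" "\<forall>i. 0 \<le> \<theta> i"
  shows "((\<lambda>\<tau>. cov_det \<tau> \<theta>) has_real_derivative deriv (\<lambda>\<tau>. cov_det \<tau> \<theta>) \<tau>) (at \<tau>)"
proof -
  obtain xs where xs: "cov_det = cov_det_list xs" using cov_det_some by blast
  have "(\<lambda>\<tau>. laplace_det (correlated_form b \<tau>) (map (\<lambda>i. (\<theta> i, w i)) xs)) differentiable (at \<tau>)"
  proof (rule conjunct2[OF laplace_det_differentiable])
    show "(\<lambda>\<tau>. correlated_form b \<tau> u v) differentiable (at \<tau>)" for u v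
      unfolding correlated_form_def
      by (intro differentiable_add differentiable_mult differentiable_const differentiable_ident)
    show "0 \<le> tilted_form (correlated_form b \<tau>) ls u u" if "\<forall>(l, w)\<in>set ls. 0 \<le> l" for ls u
      using laplace_transform_squares_tilted[OF covariance_copies[OF assms(1)] that] by blast
  qed (use assms(2) in auto)
  then show ?thesis
    unfolding xs cov_det_list_def by (simp add: DERIV_deriv_iff_real_differentiable)
qed

text \<open>
  The functionals split into those of the first and those of the second component, so the integrand
  is a product of one weight for each component.
\<close>

lemma laplace_mono:
  assumes "0 \<le> s" "s \<le> t" "t \<le> 1" "\<forall>i. 0 \<le> \<theta> i"
  shows "laplace s \<theta> \<le> laplace t \<theta>"
proof -
  define J where "J = {i \<in> I. snd (w i) = 0}"
  obtain xs where xs: "distinct xs" "set xs = J"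
    using finite_distinct_list[of J] finite_I by (auto simp: J_def)
  obtain ys where ys: "distinct ys" "set ys = I - J"
    using finite_distinct_list[of "I - J"] finite_I by auto
  have "(\<Prod>i\<in>I. exp (- \<theta> i * (w i \<bullet> z)\<^sup>2 / 2)) =
     gauss_weight (map (\<lambda>i. (\<theta> i, fst (w i))) xs) (fst z) * gauss_weight (map (\<lambda>i. (\<theta> i, snd (w i))) ys) (snd z)" for z
  proof -
    have "(\<Prod>i\<in>I. exp (- \<theta> i * (w i \<bullet> z)\<^sup>2 / 2)) =
      (\<Prod>i\<in>J. exp (- \<theta> i * (w i \<bullet> z)\<^sup>2 / 2)) * (\<Prod>i\<in>I - J. exp (- \<theta> i * (w i \<bullet> z)\<^sup>2 / 2))"
      using finite_I by (subst prod.subset_diff[of J I]) (auto simp: J_def mult.commute)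
    also have "(\<Prod>i\<in>J. exp (- \<theta> i * (w i \<bullet> z)\<^sup>2 / 2)) = (\<Prod>i\<in>J. exp (- \<theta> i * (fst (w i) \<bullet> fst z)\<^sup>2 / 2))"
      by (intro prod.cong) (auto simp: J_def inner_prod_def)
    also have "(\<Prod>i\<in>I - J. exp (- \<theta> i * (w i \<bullet> z)\<^sup>2 / 2)) = (\<Prod>i\<in>I - J. exp (- \<theta> i * (snd (w i) \<bullet> snd z)\<^sup>2 / 2))"
      by (intro prod.cong) (auto simp: J_def inner_prod_def dest: one_block)
    finally show ?thesis using xs ys by (simp add: gauss_weight_map)
  qed
  then show ?thesis
    unfolding laplace_def using assms
    by (simp, intro correlated_laplace_mono[OF covariance sin_integral]) auto
qed

lemma cov_det_deriv_nonpos: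
  assumes "0 < \<tau>" "\<tau> < 1" "\<forall>i. 0 \<le> \<theta> i"
  shows "deriv (\<lambda>\<tau>. cov_det \<tau> \<theta>) \<tau> \<le> 0"
proof -
  have "mono_on {0..1} (\<lambda>\<tau>. - cov_det \<tau> \<theta>)"
  proof (rule mono_onI)
    fix s t :: real assume st: "s \<in> {0..1}" "t \<in> {0..1}" "s \<le> t"
    then have "1 / sqrt (cov_det s \<theta>) \<le> 1 / sqrt (cov_det t \<theta>)"
      using laplace_mono[of s t \<theta>] laplace_eq[of s \<theta>] laplace_eq[of t \<theta>] assms(3) by simp
    then show "- cov_det s \<theta> \<le> - cov_det t \<theta>"
      using cov_det_pos[of s \<theta>] cov_det_pos[of t \<theta>] st assms(3) by (simp add: field_simps)
  qed
  moreover have "((\<lambda>\<tau>. - cov_det \<tau> \<theta>) has_real_derivative - deriv (\<lambda>\<tau>. cov_det \<tau> \<theta>) \<tau>) (at \<tau>)"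
    using assms by (intro DERIV_minus cov_det_differentiable) auto
  moreover have "\<tau> \<in> interior {0..1}" using assms by (simp add: interior_atLeastAtMost_real)
  ultimately have "0 \<le> - deriv (\<lambda>\<tau>. cov_det \<tau> \<theta>) \<tau>" by (rule mono_on_imp_deriv_nonneg)
  then show ?thesis by simp
qed

text \<open>
  Being affine in a variable is a linear condition on values, so it passes from the determinant to
  its derivative in \<open>\<tau>\<close>; the sign condition is the monotonicity.
\<close>

lemma cov_det_deriv_coefficients:
  assumes \<tau>: "0 < \<tau>" "\<tau> < 1"
  obtains g where "\<And>J. 0 \<le> g J" and "\<And>\<theta>. \<forall>i. 0 \<le> \<theta> i \<Longrightarrow>
    - deriv (\<lambda>\<tau>. cov_det \<tau> \<theta>) \<tau> = (\<Sum>J\<in>Pow I. g J * (\<Prod>j\<in>J. \<theta> j))"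
proof -
  define f where "f \<theta> = - deriv (\<lambda>\<tau>. cov_det \<tau> \<theta>) \<tau>" for \<theta>
  have der: "((\<lambda>\<tau>. cov_det \<tau> \<theta>) has_real_derivative - f \<theta>) (at \<tau>)" if "\<forall>i. 0 \<le> \<theta> i" for \<theta>
    unfolding f_def using cov_det_differentiable[of \<tau> \<theta>] that \<tau> by simp
  have "\<exists>g. (\<forall>J. 0 \<le> g J) \<and> (\<forall>\<theta>. (\<forall>j. 0 \<le> \<theta> j) \<longrightarrow> (\<forall>j. j \<notin> I \<longrightarrow> \<theta> j = 0) \<longrightarrow>
    f \<theta> = (\<Sum>J\<in>Pow I. g J * (\<Prod>j\<in>J. \<theta> j)))"
  proof (rule multiaffine_nonneg_coefficients[OF finite_I])
    fix \<theta> :: "'i \<Rightarrow> real" and i and t :: real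
    assume a: "\<forall>j. 0 \<le> \<theta> j" "i \<in> I" "0 \<le> t"
    have up: "\<forall>j. 0 \<le> (\<theta>(i := e)) j" if "0 \<le> e" for e using a that by simp
    have "((\<lambda>\<tau>. (1 - t) * cov_det \<tau> (\<theta>(i := 0)) + t * cov_det \<tau> (\<theta>(i := 1))) has_real_derivative
        (1 - t) * (- f (\<theta>(i := 0))) + t * (- f (\<theta>(i := 1)))) (at \<tau>)"
      by (intro DERIV_add DERIV_cmult der up) auto
    then have "((\<lambda>\<tau>. cov_det \<tau> (\<theta>(i := t))) has_real_derivative
        (1 - t) * (- f (\<theta>(i := 0))) + t * (- f (\<theta>(i := 1)))) (at \<tau>)"
    proof (rule has_field_derivative_transform_within_open)
      show "(1 - t) * cov_det \<sigma> (\<theta>(i := 0)) + t * cov_det \<sigma> (\<theta>(i := 1)) = cov_det \<sigma> (\<theta>(i := t))"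
        if "\<sigma> \<in> {0<..<1}" for \<sigma>
        by (rule cov_det_affine[symmetric]) (use that a in auto)
    qed (use \<tau> in auto)
    from DERIV_unique[OF this der[of "\<theta>(i := t)", OF up[OF a(3)]]]
    show "f (\<theta>(i := t)) = (1 - t) * f (\<theta>(i := 0)) + t * f (\<theta>(i := 1))"
      by (simp add: algebra_simps)
  next
    show "0 \<le> f \<theta>" if "\<forall>j. 0 \<le> \<theta> j" for \<theta>
      using cov_det_deriv_nonpos[OF \<tau> that] by (simp add: f_def)
  qed
  then obtain g where g: "\<And>J. 0 \<le> g J" "\<And>\<theta>. \<forall>j. 0 \<le> \<theta> j \<Longrightarrow> \<forall>j. j \<notin> I \<longrightarrow> \<theta> j = 0 \<Longrightarrow>
    f \<theta> = (\<Sum>J\<in>Pow I. g J * (\<Prod>j\<in>J. \<theta> j))" by blast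
  have "f \<theta> = (\<Sum>J\<in>Pow I. g J * (\<Prod>j\<in>J. \<theta> j))" if "\<forall>i. 0 \<le> \<theta> i" for \<theta>
  proof -
    let ?m = "\<lambda>i. if i \<in> I then \<theta> i else 0"
    have "cov_det \<tau> \<theta> = cov_det \<tau> ?m" for \<tau> by (rule cov_det_cong) simp
    then have "f \<theta> = f ?m" by (simp add: f_def)
    also have "\<dots> = (\<Sum>J\<in>Pow I. g J * (\<Prod>j\<in>J. ?m j))" using that by (intro g(2)) auto
    also have "\<dots> = (\<Sum>J\<in>Pow I. g J * (\<Prod>j\<in>J. \<theta> j))"
      by (intro sum.cong arg_cong2[of _ _ _ _ "(*)"] prod.cong) auto
    finally show ?thesis .
  qed
  with g(1) show thesis by (intro that[of g]) (simp_all add: f_def)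
qed
end

section \<open>Monotonicity for polynomials in exponentials\<close>

text \<open>
  Multiplying the coefficients of a polynomial in several variables by the moments of random
  variables \<open>s\<^sub>i\<close> with values in \<open>[0, 1]\<close> means to substitute \<open>\<sigma>\<^sub>i s\<^sub>i\<close> for \<open>\<sigma>\<^sub>i\<close> and to take the
  expectation.  The cube \<open>[0, 1]\<^sup>I\<close> is closed under this substitution, so nonnegativity on the cube is
  preserved, and the multiplication can be repeated.
\<close>

lemma moment_multiplier_nonneg:
  fixes s :: "'i \<Rightarrow> 'z \<Rightarrow> real" and a :: "('i \<Rightarrow> nat) \<Rightarrow> real"
  assumes "prob_space N" and s [measurable]: "\<And>i. s i \<in> borel_measurable N"
    and s01: "\<And>i z. 0 \<le> s i z \<and> s i z \<le> 1"
    and nonneg: "\<And>\<sigma>. \<forall>i. 0 \<le> \<sigma> i \<and> \<sigma> i \<le> 1 \<Longrightarrow> 0 \<le> (\<Sum>\<kappa>\<in>A. a \<kappa> * (\<Prod>i\<in>I. \<sigma> i ^ \<kappa> i))"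
    and \<sigma>: "\<forall>i. 0 \<le> \<sigma> i \<and> \<sigma> i \<le> 1"
  shows "0 \<le> (\<Sum>\<kappa>\<in>A. (a \<kappa> * (\<integral>z. (\<Prod>i\<in>I. s i z ^ \<kappa> i) \<partial>N)) * (\<Prod>i\<in>I. \<sigma> i ^ \<kappa> i))"
proof -
  interpret prob_space N by fact
  have "\<bar>\<Prod>i\<in>I. s i z ^ \<kappa> i\<bar> \<le> 1" for z \<kappa>
    unfolding abs_prod using s01 by (intro prod_le_1) (auto simp: power_le_one)
  then have int: "integrable N (\<lambda>z. (\<Prod>i\<in>I. s i z ^ \<kappa> i))" for \<kappa> :: "'i \<Rightarrow> nat"
    by (intro integrable_const_bound[where B=1]) auto
  have "0 \<le> (\<integral>z. (\<Sum>\<kappa>\<in>A. (a \<kappa> * (\<Prod>i\<in>I. \<sigma> i ^ \<kappa> i)) * (\<Prod>i\<in>I. s i z ^ \<kappa> i)) \<partial>N)"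
  proof (rule integral_nonneg_AE, rule AE_I2)
    fix z
    have "0 \<le> (\<Sum>\<kappa>\<in>A. a \<kappa> * (\<Prod>i\<in>I. (\<sigma> i * s i z) ^ \<kappa> i))"
      using s01 \<sigma> by (intro nonneg) (auto intro: mult_le_one)
    then show "0 \<le> (\<Sum>\<kappa>\<in>A. (a \<kappa> * (\<Prod>i\<in>I. \<sigma> i ^ \<kappa> i)) * (\<Prod>i\<in>I. s i z ^ \<kappa> i))"
      by (simp add: power_mult_distrib prod.distrib mult.assoc)
  qed
  also have "\<dots> = (\<Sum>\<kappa>\<in>A. (a \<kappa> * (\<Prod>i\<in>I. \<sigma> i ^ \<kappa> i)) * (\<integral>z. (\<Prod>i\<in>I. s i z ^ \<kappa> i) \<partial>N))"
    using int by (subst Bochner_Integration.integral_sum) auto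
  finally show ?thesis by (simp add: mult_ac)
qed

lemma inverse_sqrt_deriv:
  fixes d x :: real
  assumes "x \<noteq> 0"
  shows "- (d * (inverse x / 2)) / (x * x) = - d / 2 * (1 / x) ^ 3"
  using assms by (simp add: power3_eq_cube field_simps)

lemma times_poly_pderiv:
  fixes p :: "real poly"
  shows "s * poly (pderiv p) s = (\<Sum>k\<le>degree p. real k * coeff p k * s ^ k)"
proof -
  let ?q = "pCons 0 (pderiv p)"
  have coeff: "coeff ?q k = real k * coeff p k" for k
    by (cases k) (simp_all add: coeff_pderiv)
  have "degree ?q \<le> degree p"
    by (rule degree_le) (simp add: coeff coeff_eq_0 del: coeff_pCons_Suc)
  then have "poly ?q s = (\<Sum>k\<le>degree p. coeff ?q k * s ^ k)"
    unfolding poly_altdef by (intro sum.mono_neutral_left) (auto simp: coeff_eq_0)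
  then show ?thesis by (simp add: coeff)
qed

context correlated_blocks
begin

definition slab_weight :: "'i \<Rightarrow> 'a \<times> 'a \<Rightarrow> real" where
  "slab_weight i z = exp (- (w i \<bullet> z)\<^sup>2 / 2)"

lemma slab_weight_bounds: "0 \<le> slab_weight i z \<and> slab_weight i z \<le> 1"
  by (simp add: slab_weight_def)

lemma slab_weight_measurable:
  assumes "\<bar>\<tau>\<bar> \<le> 1" shows "slab_weight i \<in> borel_measurable (correlated_copies M \<tau>)"
proof -
  have "sets (correlated_copies M \<tau>) = sets borel"
    using covariance_copies[OF assms] by (simp add: has_covariance_form_def)
  then show ?thesis
    unfolding slab_weight_def[abs_def] measurable_cong_sets[OF _ refl] by measurable
qed

lemma laplace_moment: "laplace \<tau> (\<lambda>i. real (\<kappa> i)) = (\<integral>z. (\<Prod>i\<in>I. slab_weight i z ^ \<kappa> i) \<partial>correlated_copies M \<tau>)"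
  by (simp add: laplace_def slab_weight_def exp_of_nat_mult[symmetric])

lemma polynomial_product_expansion:
  fixes p :: "real poly"
  shows "(\<Prod>i\<in>I. poly p (\<sigma> i)) = (\<Sum>\<kappa>\<in>PiE I (\<lambda>_. {..degree p}). (\<Prod>i\<in>I. coeff p (\<kappa> i)) * (\<Prod>i\<in>I. \<sigma> i ^ \<kappa> i))"
  unfolding poly_altdef using finite_I by (subst prod_sum_PiE) (auto simp: prod.distrib)

text \<open>
  The expectation is expanded into the finite sum \<open>F \<tau>\<close> of Laplace transforms, whose derivative
  is a combination, with the nonnegative coefficients of the preceding section, of the sums
  \<open>\<Sum>\<kappa>. a \<kappa> * (\<Prod>j\<in>J. \<kappa> j) * L \<kappa> ^ 3\<close>.  Each of these is nonnegative: without \<open>L\<close> the sum is, at the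
  point \<open>\<sigma>\<close> of the cube, the product of the factors \<open>\<sigma> j * p'(\<sigma> j)\<close> for \<open>j \<in> J\<close> and \<open>p (\<sigma> i)\<close> for
  the other \<open>i\<close>, and each factor \<open>L\<close> is a multiplication by moments.
\<close>

lemma polynomial_correlation_mono:
  fixes p :: "real poly"
  assumes p: "\<And>s. 0 \<le> s \<Longrightarrow> s \<le> 1 \<Longrightarrow> 0 \<le> poly p s"
    and p': "\<And>s. 0 \<le> s \<Longrightarrow> s \<le> 1 \<Longrightarrow> 0 \<le> poly (pderiv p) s"
  shows "(\<integral>z. (\<Prod>i\<in>I. poly p (slab_weight i z)) \<partial>correlated_copies M 0)
    \<le> (\<integral>z. (\<Prod>i\<in>I. poly p (slab_weight i z)) \<partial>correlated_copies M 1)"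
proof -
  define A where "A = PiE I (\<lambda>_. {..degree p})"
  define a where "a \<kappa> = (\<Prod>i\<in>I. coeff p (\<kappa> i))" for \<kappa>
  define r where "r \<kappa> i = real (\<kappa> i)" for \<kappa> :: "'i \<Rightarrow> nat" and i
  have r: "\<forall>i. 0 \<le> r \<kappa> i" for \<kappa> by (simp add: r_def)
  define F where "F \<tau> = (\<Sum>\<kappa>\<in>A. a \<kappa> * (1 / sqrt (cov_det \<tau> (r \<kappa>))))" for \<tau>
  have F_eq: "(\<integral>z. (\<Prod>i\<in>I. poly p (slab_weight i z)) \<partial>correlated_copies M \<tau>) = F \<tau>" if "\<bar>\<tau>\<bar> \<le> 1" for \<tau>
  proof -
    interpret N: prob_space "correlated_copies M \<tau>"
      using covariance_copies[OF that] by (simp add: has_covariance_form_def)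
    note [measurable] = slab_weight_measurable[OF that]
    have "\<bar>\<Prod>i\<in>I. slab_weight i z ^ \<kappa> i\<bar> \<le> 1" for z \<kappa>
      unfolding abs_prod using slab_weight_bounds by (intro prod_le_1) (auto simp: power_le_one)
    then have int: "integrable (correlated_copies M \<tau>) (\<lambda>z. (\<Prod>i\<in>I. slab_weight i z ^ \<kappa> i))" for \<kappa> :: "'i \<Rightarrow> nat"
      by (intro N.integrable_const_bound[where B=1]) auto
    have "(\<integral>z. (\<Prod>i\<in>I. poly p (slab_weight i z)) \<partial>correlated_copies M \<tau>)
        = (\<Sum>\<kappa>\<in>A. a \<kappa> * laplace \<tau> (r \<kappa>))"
      unfolding polynomial_product_expansion using int
      by (subst Bochner_Integration.integral_sum) (auto simp: A_def a_def r_def[abs_def] laplace_moment)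
    also have "\<dots> = F \<tau>" using laplace_eq[OF that r] by (simp add: F_def)
    finally show ?thesis .
  qed
  have F_deriv: "(F has_real_derivative
      (\<Sum>\<kappa>\<in>A. a \<kappa> * (- deriv (\<lambda>\<tau>. cov_det \<tau> (r \<kappa>)) \<tau> / 2 * (1 / sqrt (cov_det \<tau> (r \<kappa>))) ^ 3))) (at \<tau>)"
    if "\<bar>\<tau>\<bar> \<le> 1" for \<tau>
    unfolding F_def
  proof (intro DERIV_sum DERIV_cmult)
    fix \<kappa>
    have pos: "0 < cov_det \<tau> (r \<kappa>)" using cov_det_pos[OF that r] .
    have "((\<lambda>\<tau>. 1 / sqrt (cov_det \<tau> (r \<kappa>))) has_real_derivative
       - (deriv (\<lambda>\<tau>. cov_det \<tau> (r \<kappa>)) \<tau> * (inverse (sqrt (cov_det \<tau> (r \<kappa>))) / 2)) / (sqrt (cov_det \<tau> (r \<kappa>)) * sqrt (cov_det \<tau> (r \<kappa>)))) (at \<tau>)"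
      using pos by (auto intro!: derivative_eq_intros cov_det_differentiable[OF that r])
    also have "- (deriv (\<lambda>\<tau>. cov_det \<tau> (r \<kappa>)) \<tau> * (inverse (sqrt (cov_det \<tau> (r \<kappa>))) / 2)) / (sqrt (cov_det \<tau> (r \<kappa>)) * sqrt (cov_det \<tau> (r \<kappa>)))
       = - deriv (\<lambda>\<tau>. cov_det \<tau> (r \<kappa>)) \<tau> / 2 * (1 / sqrt (cov_det \<tau> (r \<kappa>))) ^ 3"
      by (rule inverse_sqrt_deriv) (use pos in simp)
    finally show "((\<lambda>\<tau>. 1 / sqrt (cov_det \<tau> (r \<kappa>))) has_real_derivative
       - deriv (\<lambda>\<tau>. cov_det \<tau> (r \<kappa>)) \<tau> / 2 * (1 / sqrt (cov_det \<tau> (r \<kappa>))) ^ 3) (at \<tau>)" .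
  qed
  have F'_nonneg: "0 \<le> (\<Sum>\<kappa>\<in>A. a \<kappa> * (- deriv (\<lambda>\<tau>. cov_det \<tau> (r \<kappa>)) \<tau> / 2 * (1 / sqrt (cov_det \<tau> (r \<kappa>))) ^ 3))"
    if \<tau>: "0 < \<tau>" "\<tau> < 1" for \<tau>
  proof -
    have \<tau>': "\<bar>\<tau>\<bar> \<le> 1" using \<tau> by simp
    obtain g where g: "\<And>J. 0 \<le> g J" "\<And>\<theta>. \<forall>i. 0 \<le> \<theta> i \<Longrightarrow>
      - deriv (\<lambda>\<tau>. cov_det \<tau> \<theta>) \<tau> = (\<Sum>J\<in>Pow I. g J * (\<Prod>j\<in>J. \<theta> j))"
      using cov_det_deriv_coefficients[OF \<tau>] by metis
    define L where "L \<kappa> = (\<integral>z. (\<Prod>i\<in>I. slab_weight i z ^ \<kappa> i) \<partial>correlated_copies M \<tau>)" for \<kappa>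
    have L: "1 / sqrt (cov_det \<tau> (r \<kappa>)) = L \<kappa>" for \<kappa>
      using laplace_eq[OF \<tau>' r, of \<kappa>] laplace_moment[of \<tau> \<kappa>] by (simp add: L_def r_def[abs_def])
    have J_nonneg: "0 \<le> (\<Sum>\<kappa>\<in>A. a \<kappa> * (\<Prod>j\<in>J. r \<kappa> j) * L \<kappa> ^ 3)" if J: "J \<subseteq> I" for J
    proof -
      define c where "c \<kappa> = a \<kappa> * (\<Prod>j\<in>J. r \<kappa> j)" for \<kappa>
      have c: "0 \<le> (\<Sum>\<kappa>\<in>A. c \<kappa> * (\<Prod>i\<in>I. \<sigma> i ^ \<kappa> i))" if \<sigma>: "\<forall>i. 0 \<le> \<sigma> i \<and> \<sigma> i \<le> 1" for \<sigma>
      proof -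
        let ?q = "\<lambda>i k. coeff p k * (if i \<in> J then real k else 1) * \<sigma> i ^ k"
        have "(\<Sum>k\<le>degree p. ?q i k) = (if i \<in> J then \<sigma> i * poly (pderiv p) (\<sigma> i) else poly p (\<sigma> i))" for i
          using times_poly_pderiv[of "\<sigma> i" p] by (simp add: poly_altdef mult_ac)
        then have "0 \<le> (\<Prod>i\<in>I. \<Sum>k\<le>degree p. ?q i k)"
          using \<sigma> p p' by (intro prod_nonneg) auto
        also have "\<dots> = (\<Sum>\<kappa>\<in>A. \<Prod>i\<in>I. ?q i (\<kappa> i))"
          unfolding A_def using finite_I by (subst prod_sum_PiE) auto
        also have "\<dots> = (\<Sum>\<kappa>\<in>A. c \<kappa> * (\<Prod>i\<in>I. \<sigma> i ^ \<kappa> i))"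
        proof (intro sum.cong refl)
          fix \<kappa>
          have "(\<Prod>i\<in>I. if i \<in> J then real (\<kappa> i) else 1) = (\<Prod>j\<in>J. r \<kappa> j)"
            using J finite_I by (subst prod.If_cases) (auto simp: r_def Int_absorb1 Int_commute)
          then show "(\<Prod>i\<in>I. ?q i (\<kappa> i)) = c \<kappa> * (\<Prod>i\<in>I. \<sigma> i ^ \<kappa> i)"
            by (simp add: prod.distrib c_def a_def)
        qed
        finally show ?thesis .
      qed
      interpret N: prob_space "correlated_copies M \<tau>"
        using covariance_copies[OF \<tau>'] by (simp add: has_covariance_form_def)
      have step: "0 \<le> (\<Sum>\<kappa>\<in>A. (e \<kappa> * L \<kappa>) * (\<Prod>i\<in>I. \<sigma> i ^ \<kappa> i))"
        if "\<And>\<sigma>. \<forall>i. 0 \<le> \<sigma> i \<and> \<sigma> i \<le> 1 \<Longrightarrow> 0 \<le> (\<Sum>\<kappa>\<in>A. e \<kappa> * (\<Prod>i\<in>I. \<sigma> i ^ \<kappa> i))"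
          and "\<forall>i. 0 \<le> \<sigma> i \<and> \<sigma> i \<le> 1" for e \<sigma>
        unfolding L_def
        by (rule moment_multiplier_nonneg[OF N.prob_space_axioms slab_weight_measurable[OF \<tau>'] slab_weight_bounds that])
      \<comment> \<open>Three multiplications by moments, evaluated at the corner of the cube where all variables are 1.\<close>
      have "0 \<le> (\<Sum>\<kappa>\<in>A. (((c \<kappa> * L \<kappa>) * L \<kappa>) * L \<kappa>) * (\<Prod>i\<in>I. (\<lambda>_. 1) i ^ \<kappa> i))"
        by (rule step[OF step[OF step[OF c]]]) auto
      then show ?thesis by (simp add: c_def power3_eq_cube mult.assoc)
    qed
    have "(\<Sum>\<kappa>\<in>A. a \<kappa> * (- deriv (\<lambda>\<tau>. cov_det \<tau> (r \<kappa>)) \<tau> / 2 * (1 / sqrt (cov_det \<tau> (r \<kappa>))) ^ 3))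
      = (\<Sum>\<kappa>\<in>A. \<Sum>J\<in>Pow I. g J / 2 * (a \<kappa> * (\<Prod>j\<in>J. r \<kappa> j) * L \<kappa> ^ 3))"
      unfolding L g(2)[OF r] sum_divide_distrib sum_distrib_left sum_distrib_right
      by (intro sum.cong refl) simp
    also have "\<dots> = (\<Sum>J\<in>Pow I. g J / 2 * (\<Sum>\<kappa>\<in>A. a \<kappa> * (\<Prod>j\<in>J. r \<kappa> j) * L \<kappa> ^ 3))"
      by (subst sum.swap) (simp add: sum_distrib_left)
    also have "\<dots> \<ge> 0" using g(1) by (intro sum_nonneg mult_nonneg_nonneg[OF _ J_nonneg]) auto
    finally show ?thesis .
  qed
  have "F 0 \<le> F 1"
  proof (rule DERIV_nonneg_imp_increasing_open[where f=F])
    show "\<exists>y. (F has_real_derivative y) (at \<tau>) \<and> 0 \<le> y" if "0 < \<tau>" "\<tau> < 1" for \<tau>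
      using F_deriv[of \<tau>] F'_nonneg[of \<tau>] that by (intro exI conjI) auto
    show "continuous_on {0..1} F"
      by (intro continuous_at_imp_continuous_on ballI DERIV_isCont[OF F_deriv]) auto
  qed simp
  then show ?thesis by (simp add: F_eq)
qed
end

section \<open>Polynomial approximation of a threshold\<close>

text \<open>
  The exponent \<open>N = m * 2 ^ m\<close> makes \<open>N * s ^ m = m * (2 * s) ^ m\<close>, which tends to infinity for
  \<open>s \<ge> 1/2\<close> and to 0 for \<open>0 \<le> s < 1/2\<close>.  The additional factor \<open>m\<close> settles the boundary case \<open>s = 1/2\<close>,
  so the limit is the indicator of the closed half-line without any exceptional point.
\<close>

definition threshold_poly :: "nat \<Rightarrow> real poly" where
  "threshold_poly m = 1 - (1 - monom 1 m) ^ (m * 2 ^ m)"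

lemma poly_threshold_poly: "poly (threshold_poly m) s = 1 - (1 - s ^ m) ^ (m * 2 ^ m)"
  by (simp add: threshold_poly_def poly_monom)

lemma threshold_poly_bounds:
  assumes "0 \<le> s" "s \<le> 1"
  shows "0 \<le> poly (threshold_poly m) s" "poly (threshold_poly m) s \<le> 1"
    "0 \<le> poly (pderiv (threshold_poly m)) s"
proof -
  have s: "0 \<le> s ^ m" "s ^ m \<le> 1" using assms by (simp_all add: power_le_one)
  show "0 \<le> poly (threshold_poly m) s" "poly (threshold_poly m) s \<le> 1"
    using s by (simp_all add: poly_threshold_poly power_le_one)
  show "0 \<le> poly (pderiv (threshold_poly m)) s"
    using s assms(1) by (simp add: threshold_poly_def pderiv_diff pderiv_power pderiv_monom poly_monom)
qed

text \<open>
  Above the threshold \<open>1 - x \<le> exp (- x)\<close> is used, below it Bernoulli's inequality.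
\<close>

lemma threshold_poly_limit:
  assumes "0 \<le> s" "s \<le> 1"
  shows "(\<lambda>m. poly (threshold_poly m) s) \<longlonglongrightarrow> (if 1 / 2 \<le> s then 1 else 0)"
proof (cases "1 / 2 \<le> s")
  case True
  have "(1 - s ^ m) ^ (m * 2 ^ m) \<le> exp (- 1) ^ m" for m
  proof -
    have "(1 - s ^ m) ^ (m * 2 ^ m) \<le> exp (- (s ^ m)) ^ (m * 2 ^ m)"
      using exp_ge_add_one_self[of "- (s ^ m)"] assms by (intro power_mono) (simp_all add: power_le_one)
    also have "\<dots> = exp (- (real m * (2 * s) ^ m))"
      by (simp add: exp_of_nat_mult[symmetric] power_mult_distrib mult_ac)
    also have "\<dots> \<le> exp (- real m)"
      using True one_le_power[of "2 * s" m] mult_left_mono[of 1 "(2 * s) ^ m" "real m"] by simp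
    also have "\<dots> = exp (- 1) ^ m" by (simp add: exp_of_nat_mult[symmetric])
    finally show ?thesis .
  qed
  then have "(\<lambda>m. (1 - s ^ m) ^ (m * 2 ^ m)) \<longlonglongrightarrow> 0"
    using assms
    by (intro tendsto_sandwich[OF _ _ tendsto_const LIMSEQ_realpow_zero[of "exp (- 1)"]] always_eventually allI)
       (auto simp: power_le_one)
  from tendsto_diff[OF tendsto_const this, of 1] True show ?thesis
    by (simp add: poly_threshold_poly)
next
  case False
  have upper: "poly (threshold_poly m) s \<le> real m * (2 * s) ^ m" for m
    using Bernoulli_inequality[of "- (s ^ m)" "m * 2 ^ m"] assms
    by (simp add: poly_threshold_poly power_le_one power_mult_distrib mult_ac)
  have lim: "(\<lambda>m. real m * (2 * s) ^ m) \<longlonglongrightarrow> 0"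
    using powser_times_n_limit_0[of "2 * s"] False assms by simp
  have "(\<lambda>m. poly (threshold_poly m) s) \<longlonglongrightarrow> 0"
    by (rule tendsto_sandwich[OF always_eventually always_eventually tendsto_const lim])
       (intro allI upper threshold_poly_bounds(1)[OF assms])+
  with False show ?thesis by simp
qed

section \<open>Intersections of slabs\<close>

text \<open>
  A slab is described by the condition \<open>1/2 \<le> exp (- (u \<bullet> x)\<^sup>2 / 2)\<close>, that is
  \<open>\<bar>u \<bullet> x\<bar> \<le> sqrt (2 * ln 2)\<close>, to match the threshold of the polynomials.
\<close>

definition slabs :: "nat set \<Rightarrow> (nat \<Rightarrow> 'a::real_inner) \<Rightarrow> 'a set" where
  "slabs I u = {x. \<forall>i\<in>I. 1 / 2 \<le> exp (- (u i \<bullet> x)\<^sup>2 / 2)}"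

lemma slabs_closed: "closed (slabs I u)"
proof -
  have "slabs I u = (\<Inter>i\<in>I. {x. 1 / 2 \<le> exp (- (u i \<bullet> x)\<^sup>2 / 2)})" by (auto simp: slabs_def)
  also have "closed \<dots>" by (intro closed_INT ballI closed_Collect_le continuous_intros) auto
  finally show ?thesis .
qed

text \<open>
  For the approximating polynomials this is the comparison of the correlations 0, where the two
  components are independent, and 1, where they coincide.  The slabs pass to the limit by dominated
  convergence.
\<close>

lemma finite_slabs_correlation:
  fixes M :: "'a::euclidean_space measure" and u v :: "nat \<Rightarrow> 'a"
  assumes cov: "has_covariance_form M b" and sin: "\<And>u. (\<integral>x. sin (u \<bullet> x) \<partial>M) = 0"
  shows "measure M (slabs {..<n} u) * measure M (slabs {..<n} v)
    \<le> measure M (slabs {..<n} u \<inter> slabs {..<n} v)"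
proof -
  have P: "prob_space M" and S [measurable_cong]: "sets M = sets borel"
    using cov by (auto simp: has_covariance_form_def)
  interpret prob_space M by (rule P)
  define f where "f u m x = (\<Prod>i<n. poly (threshold_poly m) (exp (- (u i \<bullet> x)\<^sup>2 / 2)))" for u :: "nat \<Rightarrow> 'a" and m x
  have f01: "0 \<le> f u m x" "f u m x \<le> 1" for u m x
    unfolding f_def by (auto intro!: prod_nonneg prod_le_1 threshold_poly_bounds(1,2))
  have f_abs: "\<bar>f u m x\<bar> \<le> 1" for u m x
    using f01[of u m x] by simp
  have [measurable]: "f u m \<in> borel_measurable borel" for u m
    unfolding f_def[abs_def] poly_threshold_poly by measurable
  have f_lim: "(\<lambda>m. f u m x) \<longlonglongrightarrow> indicator (slabs {..<n} u) x" for u x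
  proof -
    have "(\<lambda>m. f u m x) \<longlonglongrightarrow> (\<Prod>i<n. if 1 / 2 \<le> exp (- (u i \<bullet> x)\<^sup>2 / 2) then 1 else 0)"
      unfolding f_def by (intro tendsto_prod threshold_poly_limit) auto
    also have "(\<Prod>i<n. if 1 / 2 \<le> exp (- (u i \<bullet> x)\<^sup>2 / 2) then 1 else 0) = (indicator (slabs {..<n} u) x :: real)"
    proof (cases "x \<in> slabs {..<n} u")
      case True
      then show ?thesis by (simp add: slabs_def)
    next
      case False
      then obtain i where "i < n" "\<not> 1 / 2 \<le> exp (- (u i \<bullet> x)\<^sup>2 / 2)" by (auto simp: slabs_def)
      then show ?thesis using False by (auto intro!: prod_zero)
    qed
    finally show ?thesis .
  qed
  have slabs_sets [measurable]: "slabs {..<n} u \<in> sets borel" for u :: "nat \<Rightarrow> 'a"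
    by (intro borel_closed slabs_closed)
  let ?w = "case_sum (\<lambda>i. (u i, 0)) (\<lambda>i. (0, v i))"
  let ?I = "{..<n} <+> {..<n}"
  interpret correlated_blocks M b ?I ?w
    by unfold_locales (use cov sin in auto)
  have slab_weight: "(\<Prod>i\<in>?I. poly (threshold_poly m) (slab_weight i z)) = f u m (fst z) * f v m (snd z)" for m z
    by (subst prod.Plus) (simp_all add: slab_weight_def f_def inner_prod_def)
  have ineq: "(\<integral>x. f u m x \<partial>M) * (\<integral>x. f v m x \<partial>M) \<le> (\<integral>x. f u m x * f v m x \<partial>M)" for m
  proof -
    have "(\<integral>z. f u m (fst z) * f v m (snd z) \<partial>correlated_copies M 0)
      \<le> (\<integral>z. f u m (fst z) * f v m (snd z) \<partial>correlated_copies M 1)"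
      using polynomial_correlation_mono[of "threshold_poly m"] threshold_poly_bounds
      by (simp only: slab_weight)
    moreover have "(\<integral>z. f u m (fst z) * f v m (snd z) \<partial>correlated_copies M 0)
      = (\<integral>x. f u m x \<partial>M) * (\<integral>x. f v m x \<partial>M)"
      unfolding correlated_copies_def
      using integral_pair_mult(1)[OF P P, of "f u m" "f v m"] f_abs
      by (subst integral_distr[OF correlated_copies_measurable[OF S]])
         (simp_all add: borel_prod[symmetric])
    moreover have "(\<integral>z. f u m (fst z) * f v m (snd z) \<partial>correlated_copies M 1)
      = (\<integral>x. f u m x * f v m x \<partial>M)"
    proof -
      have "\<bar>f u m x * f v m x\<bar> \<le> 1" for x
        using mult_mono[OF f_abs f_abs] by (simp add: abs_mult)
      with integral_pair_mult(1)[OF P P, of "\<lambda>x. f u m x * f v m x" "\<lambda>_. 1"] prob_space show ?thesis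
        unfolding correlated_copies_def
        by (subst integral_distr[OF correlated_copies_measurable[OF S]])
           (simp_all add: borel_prod[symmetric])
    qed
    ultimately show ?thesis by simp
  qed
  have lim1: "(\<lambda>m. \<integral>x. f u m x \<partial>M) \<longlonglongrightarrow> measure M (slabs {..<n} u)" for u
  proof -
    have "(\<lambda>m. \<integral>x. f u m x \<partial>M) \<longlonglongrightarrow> (\<integral>x. indicator (slabs {..<n} u) x \<partial>M)"
      by (rule integral_dominated_convergence[where w="\<lambda>_. 1"]) (use f_lim f_abs in auto)
    then show ?thesis by simp
  qed
  have lim2: "(\<lambda>m. \<integral>x. f u m x * f v m x \<partial>M) \<longlonglongrightarrow> measure M (slabs {..<n} u \<inter> slabs {..<n} v)"
  proof -
    have "(\<lambda>m. \<integral>x. f u m x * f v m x \<partial>M) \<longlonglongrightarrow> (\<integral>x. indicator (slabs {..<n} u \<inter> slabs {..<n} v) x \<partial>M)"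
    proof (rule integral_dominated_convergence[where w="\<lambda>_. 1"])
      show "AE x in M. (\<lambda>m. f u m x * f v m x) \<longlonglongrightarrow> indicator (slabs {..<n} u \<inter> slabs {..<n} v) x"
        using f_lim by (intro AE_I2) (auto simp: indicator_inter_arith intro!: tendsto_mult)
      show "AE x in M. norm (f u m x * f v m x) \<le> 1" for m
        using mult_mono[OF f_abs f_abs] by (intro AE_I2) (simp add: abs_mult)
    qed auto
    then show ?thesis by simp
  qed
  show ?thesis
    by (rule LIMSEQ_le[OF tendsto_mult[OF lim1 lim1] lim2]) (use ineq in auto)
qed

text \<open>
  A nonempty set of this kind contains 0, so a hyperplane that separates it from an outside point
  can be normalized to \<open>a \<bullet> x = 1\<close>, and by symmetry the whole set lies in \<open>\<bar>a \<bullet> x\<bar> \<le> 1\<close>.  Hence the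
  complement is the union of the open sets \<open>1 < \<bar>a \<bullet> x\<bar>\<close> over the polar set, and by Lindelof's theorem
  countably many of them suffice.
\<close>

lemma closed_symmetric_convex_eq_slabs:
  fixes K :: "'a::euclidean_space set"
  assumes "closed K" "symmetric_set K" "convex K" "K \<noteq> {}"
  obtains u where "K = slabs UNIV u"
proof -
  have sym: "- y \<in> K" if "y \<in> K" for y
    using assms(2) that by (metis symmetric_set_def imageI)
  have zero: "0 \<in> K"
  proof -
    obtain y where y: "y \<in> K" using assms(4) by auto
    have "(1 / 2) *\<^sub>R y + (1 / 2) *\<^sub>R (- y) \<in> K"
      by (rule convexD[OF assms(3) y sym[OF y]]) auto
    then show ?thesis by simp
  qed
  define A where "A = {a. \<forall>y\<in>K. \<bar>a \<bullet> y\<bar> \<le> 1}"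
  define E where "E a = {x. 1 < \<bar>a \<bullet> x\<bar>}" for a :: 'a
  have open_E: "open (E a)" for a
    unfolding E_def by (intro open_Collect_less continuous_intros)
  have "- K = \<Union>(E ` A)"
  proof (intro equalityI subsetI)
    fix x assume "x \<in> - K"
    then obtain a c where a: "a \<bullet> x < c" "\<And>y. y \<in> K \<Longrightarrow> c < a \<bullet> y"
      using separating_hyperplane_closed_point[OF assms(3,1), of x] by auto
    have c: "c < 0" using a(2)[OF zero] by simp
    let ?a = "(1 / c) *\<^sub>R a"
    have lt: "?a \<bullet> y < 1" if "y \<in> K" for y
      using a(2)[OF that] c by (simp add: field_simps)
    have "?a \<in> A"
      using lt lt[OF sym] unfolding A_def by (fastforce simp: abs_le_iff)
    moreover have "x \<in> E ?a"
      using a(1) c by (simp add: E_def field_simps abs_if)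
    ultimately show "x \<in> \<Union>(E ` A)" by blast
  next
    fix x assume "x \<in> \<Union>(E ` A)"
    then show "x \<in> - K" by (fastforce simp: A_def E_def)
  qed
  moreover obtain \<F> where "\<F> \<subseteq> E ` A" "countable \<F>" "\<Union>\<F> = \<Union>(E ` A)"
    using Lindelof[of "E ` A"] open_E by blast
  moreover then obtain B where B: "countable B" "B \<subseteq> A" "\<F> = E ` B"
    by (metis countable_subset_image)
  moreover have "E 0 = {}" by (simp add: E_def)
  ultimately have K: "- K = \<Union>(E ` insert 0 B)" by simp
  \<comment> \<open>Inserting 0, whose slab is the whole space, provides an enumeration even if \<open>B\<close> is empty.\<close>
  define r where "r = from_nat_into (insert 0 B)"
  have range: "range r = insert 0 B"
    unfolding r_def using B by (intro range_from_nat_into) auto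
  define u where "u i = sqrt (2 * ln 2) *\<^sub>R r i" for i
  have "1 / 2 \<le> exp (- (u i \<bullet> x)\<^sup>2 / 2) \<longleftrightarrow> \<bar>r i \<bullet> x\<bar> \<le> 1" for i x
  proof -
    have "(u i \<bullet> x)\<^sup>2 = 2 * ln 2 * (r i \<bullet> x)\<^sup>2"
      by (simp add: u_def power_mult_distrib)
    then have "1 / 2 \<le> exp (- (u i \<bullet> x)\<^sup>2 / 2) \<longleftrightarrow> exp (- ln 2) \<le> exp (- (ln 2 * (r i \<bullet> x)\<^sup>2))"
      by (simp add: exp_minus)
    also have "\<dots> \<longleftrightarrow> (r i \<bullet> x)\<^sup>2 \<le> 1" by simp
    also have "\<dots> \<longleftrightarrow> \<bar>r i \<bullet> x\<bar> \<le> 1" by (rule abs_square_le_1)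
    finally show ?thesis .
  qed
  then have "slabs UNIV u = {x. \<forall>i. \<bar>r i \<bullet> x\<bar> \<le> 1}"
    unfolding slabs_def by (simp only: ball_UNIV)
  also have "\<dots> = - \<Union>(E ` range r)"
    unfolding E_def not_le[symmetric] by blast
  also have "\<dots> = K" unfolding range K[symmetric] by simp
  finally show thesis using that by blast
qed

section \<open>The Gaussian correlation inequality\<close>

lemma gaussian_correlation:
  fixes K L :: "'a::euclidean_space set" and M :: "'a measure"
  assumes K: "closed K" "symmetric_set K" "convex K"
    and L: "closed L" "symmetric_set L" "convex L"
    and M: "centered_gaussian_measure M"
  shows "measure M K * measure M L \<le> measure M (K \<inter> L)"
proof (cases "K = {} \<or> L = {}")
  case True
  then show ?thesis by auto
next
  case False
  obtain b where cov: "has_covariance_form M b" and sin: "\<And>u. (\<integral>x. sin (u \<bullet> x) \<partial>M) = 0"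
    using centered_gaussian_measure_covariance[OF M] by blast
  interpret prob_space M using cov by (simp add: has_covariance_form_def)
  have S: "sets M = sets borel" using cov by (simp add: has_covariance_form_def)
  obtain u v where u: "K = slabs UNIV u" and v: "L = slabs UNIV v"
    using closed_symmetric_convex_eq_slabs K L False by metis
  have slab_sets: "slabs {..<n} u \<in> sets M" for n and u :: "nat \<Rightarrow> 'a"
    unfolding S by (intro borel_closed slabs_closed)
  have anti: "slabs {..<n} u \<subseteq> slabs {..<m} u" if "m \<le> n" for m n and u :: "nat \<Rightarrow> 'a"
    using that by (auto simp: slabs_def)
  have Inter: "(\<Inter>n. slabs {..<n} u) = slabs UNIV u" for u :: "nat \<Rightarrow> 'a"
    by (auto simp: slabs_def)
  have lim: "(\<lambda>n. measure M (slabs {..<n} u)) \<longlonglongrightarrow> measure M (slabs UNIV u)" for u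
    unfolding Inter[symmetric] using slab_sets anti by (intro finite_Lim_measure_decseq) (auto simp: decseq_def)
  have "(\<lambda>n. measure M (slabs {..<n} u \<inter> slabs {..<n} v)) \<longlonglongrightarrow> measure M (\<Inter>n. slabs {..<n} u \<inter> slabs {..<n} v)"
  proof (rule finite_Lim_measure_decseq)
    show "range (\<lambda>n. slabs {..<n} u \<inter> slabs {..<n} v) \<subseteq> sets M" using slab_sets by auto
    show "decseq (\<lambda>n. slabs {..<n} u \<inter> slabs {..<n} v)"
      unfolding decseq_def by (intro allI impI Int_mono anti)
  qed
  also have "(\<Inter>n. slabs {..<n} u \<inter> slabs {..<n} v) = K \<inter> L"
    unfolding u v Inter[symmetric] by blast
  finally have limI: "(\<lambda>n. measure M (slabs {..<n} u \<inter> slabs {..<n} v)) \<longlonglongrightarrow> measure M (K \<inter> L)" .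
  show ?thesis
    unfolding u v
    by (rule LIMSEQ_le[OF tendsto_mult[OF lim lim] limI[unfolded u v]])
       (use finite_slabs_correlation[OF cov sin] in auto)
qed

theorem theorem1:
  fixes K L :: "(real ^ 'd) set" and \<mu> :: "(real ^ 'd) measure"
  assumes "closed K" and "symmetric_set K" and "convex K"
    and "closed L" and "symmetric_set L" and "convex L"
    and "centered_gaussian_measure \<mu>"
  shows "measure \<mu> (K \<inter> L) \<ge> measure \<mu> K * measure \<mu> L"
  using gaussian_correlation[OF assms] by simp

end
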